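(* For the free-infinitely divisible Voiculescu transform $$V_{\tilde Y_C}(iw)=-F_{\tilde Y_C}(iw)=i\Big[1+\frac{w^2}{2}\,\zeta\Big(2,\frac{w}{2}\Big)-\frac{w^2}{4}\,\zeta\Big(2,\frac{w}{4}\Big)\Big],\qquad w>0,$$ the characteristics are given by $a_{\tilde Y_C}=b_{\tilde Y_C}=0$, and the measure $\rho_{\tilde Y_C}$ is such that $\rho_{\tilde Y_C}(\mathbb{R})=2K-1$ and, for all $s\in\mathbb{R}$, $$\mathfrak{F}[\rho_{\tilde Y_C}\,;\,s]=2\cosh(s)\Big(K-\int_0^s\frac{x}{\cosh(x)}\,dx\Big)-s\tanh(s)-1=\frac{\pi}{2}\int_0^\infty\cos(sx)\,\frac{x^2}{1+x^2}\,\frac{\cosh\left(\frac{\pi x}{2}\right)}{\sinh^2\left(\frac{\pi x}{2}\right)}\,dx.$$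
   Context: $K=\frac{\mathrm{Li}_2(i)-\mathrm{Li}_2(-i)}{2i}\approx0.9159$ is the Catalan constant, where $\mathrm{Li}_2$ is the dilogarithm, given by $\mathrm{Li}_2(z)=\sum_{k\ge1}z^k/k^2$ for $|z|<1$ and extended analytically to $\mathbb{C}\setminus[1,\infty)$. Also $\zeta(s,a)=\sum_{k=0}^\infty\frac{1}{(k+a)^s}$ for $\Re(s)>1$ and $-a\notin\{0,1,2,\dots\}$. The characteristics $(a_X,b_X,\rho_X)$ of $F_X$ are the $a_X\in\mathbb{R}$, $b_X\ge0$ and finite non-negative Borel measure $\rho_X$ on $\mathbb{R}$ such that $$F_X(iw)=a_X+i\,b_X\,w+\int_{\mathbb{R}}\frac{iwx-1}{iw+x}\,\rho_X(dx),\qquad w\neq0.$$ The Voiculescu transform is $V_X=-F_X$, and $\mathfrak{F}[\rho\,;\,s]=\int_{\mathbb{R}}e^{isx}\,\rho(dx)$ is the Fourier transform. The label $\tilde Y_C$ refers to the free-probability analog of $Y_C$, the background driving Lévy process of the self-decomposable random variable $C$ with characteristic function $1/\cosh(s)$, i.e. the Lévy process in the random integral representation $C=\int_0^\infty e^{-t}\,dY_t$ with $Y=Y_C$. The function $F_{\tilde Y_C}$ is the one explicitly given in the claim.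
   Formalization: The middle expression is corrected to 2cosh(s)(K − ½∫₀ˢ x/cosh(x) dx) − s·tanh(s) − 1; as printed, without the factor ½, it is false for every s ≠ 0, since ∫₀^∞ x/cosh(x) dx = 2K makes it unbounded. *)

theory Defs
  imports "HOL-Complex_Analysis.Complex_Analysis" "HOL-Probability.Characteristic_Functions"
begin

definition slit_plane :: "complex set" where
  "slit_plane = - (complex_of_real ` {1..})"

text \<open>
  The dilogarithm is only meaningful on \<^term>\<open>slit_plane\<close>, where it is the analytic
  continuation of its power series; outside that set its values are arbitrary.
\<close>

definition dilog :: "complex \<Rightarrow> complex" where
  "dilog = (SOME f. f holomorphic_on slit_plane \<and>
     (\<forall>z. norm z < 1 \<longrightarrow> (\<lambda>k. z ^ Suc k / of_nat (Suc k) ^ 2) sums f z))"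

lemma open_slit_plane: "open slit_plane"
proof -
  have "closed (complex_of_real ` {1..})"
    by (rule closed_injective_linear_image) (auto intro: bounded_linear.linear bounded_linear_of_real injI)
  then show ?thesis by (simp add: slit_plane_def open_Compl)
qed

lemma slit_plane_iff: "z \<in> slit_plane \<longleftrightarrow> 1 - z \<notin> \<real>\<^sub>\<le>\<^sub>0"
proof -
  have "z \<in> complex_of_real ` {1..} \<longleftrightarrow> Im z = 0 \<and> 1 \<le> Re z"
    by (auto simp: image_iff complex_eq_iff)
  then show ?thesis by (auto simp: slit_plane_def complex_nonpos_Reals_iff)
qed

lemma starlike_slit_plane: "starlike slit_plane"
proof -
  have "closed_segment 0 z \<subseteq> slit_plane" if "z \<in> slit_plane" for z
  proof
    fix y assume "y \<in> closed_segment 0 z"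
    then obtain u where u: "0 \<le> u" "u \<le> 1" "y = u *\<^sub>R z" by (auto simp: in_segment)
    show "y \<in> slit_plane"
    proof (cases "Im y = 0 \<and> 1 \<le> Re y")
      case True
      then have "u \<noteq> 0" using u by auto
      then have "Im z = 0" using True u by simp
      moreover have "1 \<le> Re z"
      proof (rule ccontr)
        assume "\<not> 1 \<le> Re z"
        then have "u * Re z < u * 1" using \<open>u \<noteq> 0\<close> u by (intro mult_strict_left_mono) auto
        then show False using True u by simp
      qed
      ultimately show ?thesis using that by (auto simp: slit_plane_iff complex_nonpos_Reals_iff)
    qed (auto simp: slit_plane_iff complex_nonpos_Reals_iff)
  qed
  moreover have "0 \<in> slit_plane" by (simp add: slit_plane_iff complex_nonpos_Reals_iff)
  ultimately show ?thesis unfolding starlike_def by blast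
qed

lemma ball_subset_slit_plane: "ball 0 1 \<subseteq> slit_plane"
proof
  fix z :: complex assume "z \<in> ball 0 1"
  then have "Re z < 1" using complex_Re_le_cmod[of z] by (simp add: dist_norm)
  then show "z \<in> slit_plane" by (simp add: slit_plane_iff complex_nonpos_Reals_iff)
qed

lemma summable_dilog:
  fixes z :: complex
  assumes "norm z < 1"
  shows "summable (\<lambda>k. z ^ Suc k / of_nat (Suc k) ^ 2)"
proof (rule summable_comparison_test)
  show "\<exists>N. \<forall>n\<ge>N. norm (z ^ Suc n / of_nat (Suc n) ^ 2) \<le> norm z ^ n"
  proof (intro exI[of _ 0] allI impI)
    fix n :: nat
    have "norm (z ^ Suc n / of_nat (Suc n) ^ 2) = norm z ^ Suc n / real (Suc n) ^ 2"
      by (simp only: norm_divide norm_power norm_of_nat)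
    also have "\<dots> \<le> norm z ^ Suc n" 
      using divide_left_mono[of 1 "real (Suc n) ^ 2" "norm z ^ Suc n"] by simp
    also have "\<dots> \<le> norm z ^ n" using assms by (intro power_decreasing) auto
    finally show "norm (z ^ Suc n / of_nat (Suc n) ^ 2) \<le> norm z ^ n" .
  qed
  show "summable (\<lambda>n. norm z ^ n)" using assms by (simp add: summable_geometric)
qed

lemma dilog_exists:
  "\<exists>f. f holomorphic_on slit_plane \<and>
     (\<forall>z. norm z < 1 \<longrightarrow> (\<lambda>k. z ^ Suc k / of_nat (Suc k) ^ 2) sums f z)"
proof -
  define g :: "complex \<Rightarrow> complex" where "g z = (if z = 0 then 1 else - Ln (1 - z) / z)" for z
  have d0: "((\<lambda>z. - Ln (1 - z)) has_field_derivative 1) (at 0)"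
    by (auto intro!: derivative_eq_intros)
  have holg: "g holomorphic_on slit_plane"
  proof (rule pole_theorem_open_0[where g = "\<lambda>z. - Ln (1 - z)" and a = 0])
    show "(\<lambda>z. - Ln (1 - z)) holomorphic_on slit_plane"
      by (intro holomorphic_intros) (simp add: slit_plane_iff)
    show "g 0 = deriv (\<lambda>z. - Ln (1 - z)) 0"
      using DERIV_imp_deriv[OF d0] by (simp add: g_def)
  qed (auto simp: open_slit_plane g_def)
  have "\<exists>G. \<forall>z\<in>slit_plane. (G has_field_derivative g z) (at z)"
    using holg by (intro holomorphic_starlike_primitive[where k = "{}"])
      (auto simp: open_slit_plane starlike_slit_plane holomorphic_on_imp_continuous_on
          holomorphic_on_imp_differentiable_at)
  then obtain G where G: "\<And>z. z \<in> slit_plane \<Longrightarrow> (G has_field_derivative g z) (at z)" by blast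
  define c :: "nat \<Rightarrow> complex" where "c n = 1 / of_nat n ^ 2" for n
  have c_sums: "(\<lambda>k. z ^ Suc k / of_nat (Suc k) ^ 2) sums (\<Sum>n. c n * z ^ n)"
    and c_summable: "summable (\<lambda>n. c n * z ^ n)" if "norm z < 1" for z
  proof -
    have eq: "(\<lambda>k. z ^ Suc k / of_nat (Suc k) ^ 2) = (\<lambda>k. c (Suc k) * z ^ Suc k)"
      by (simp add: c_def)
    show *: "summable (\<lambda>n. c n * z ^ n)"
      using summable_dilog[OF that] summable_Suc_iff[of "\<lambda>n. c n * z ^ n"] unfolding eq by blast
    then show "(\<lambda>k. z ^ Suc k / of_nat (Suc k) ^ 2) sums (\<Sum>n. c n * z ^ n)"
      unfolding eq using summable_sums[OF *] sums_Suc_iff[of "\<lambda>n. c n * z ^ n"] by (simp add: c_def)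
  qed
  define S where "S z = (\<Sum>n. c n * z ^ n)" for z
  have S: "(S has_field_derivative g z) (at z)" if z: "norm z < 1" for z
  proof -
    have diffs: "diffs c n = 1 / of_nat (Suc n)" for n
      by (simp add: diffs_def c_def power2_eq_square)
    have "(S has_field_derivative (\<Sum>n. diffs c n * z ^ n)) (at z)"
      unfolding S_def using z c_summable by (intro termdiffs_strong'[where K = 1]) auto
    moreover have "(\<Sum>n. diffs c n * z ^ n) = g z"
    proof (cases "z = 0")
      case True
      have "(\<lambda>n. diffs c n * 0 ^ n) sums diffs c 0" by (rule powser_sums_zero)
      then show ?thesis using True by (simp add: g_def diffs sums_iff)
    next
      case False
      have "(\<lambda>n. (-1) ^ Suc n / of_nat n * (- z) ^ n) sums ln (1 + - z)"
        using z by (intro Ln_series) simp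
      then have "(\<lambda>n. (-1) ^ Suc (Suc n) / of_nat (Suc n) * (- z) ^ Suc n) sums ln (1 + - z)"
        by (subst sums_Suc_iff) simp
      moreover have "(-1) ^ Suc (Suc n) / of_nat (Suc n) * (- z) ^ Suc n
          = - z * (diffs c n * z ^ n)" for n
      proof -
        have "(-1) ^ n * (- z) ^ n = z ^ n" by (simp add: power_mult_distrib[symmetric])
        then show ?thesis by (simp add: diffs)
      qed
      ultimately have "(\<lambda>n. - z * (diffs c n * z ^ n)) sums ln (1 - z)" by simp
      from sums_divide[OF this, of "- z"] have "(\<lambda>n. diffs c n * z ^ n) sums (ln (1 - z) / - z)"
        using False by simp
      then show ?thesis using False by (simp add: g_def sums_iff)
    qed
    ultimately show ?thesis by simp
  qed
  have const: "\<exists>d. \<forall>z\<in>ball 0 1. S z - G z = d"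
  proof (rule has_field_derivative_zero_constant)
    fix z :: complex assume "z \<in> ball 0 1"
    then have "((\<lambda>z. S z - G z) has_field_derivative g z - g z) (at z)"
      using ball_subset_slit_plane by (intro DERIV_diff S G) auto
    then show "((\<lambda>z. S z - G z) has_field_derivative 0) (at z within ball 0 1)"
      by (simp add: has_field_derivative_at_within)
  qed simp
  then obtain d where d: "\<And>z. z \<in> ball 0 1 \<Longrightarrow> S z - G z = d" by blast
  have "(\<lambda>z. G z + d) holomorphic_on slit_plane"
    by (intro holomorphic_intros) (meson G field_differentiable_at_within field_differentiable_def holomorphic_onI)
  moreover have "(\<lambda>k. z ^ Suc k / of_nat (Suc k) ^ 2) sums (G z + d)" if "norm z < 1" for z
  proof -
    have "G z + d = S z" using d[of z] that by (simp add: algebra_simps)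
    then show ?thesis using c_sums[OF that] by (simp add: S_def)
  qed
  ultimately show ?thesis by blast
qed

lemma dilog_holomorphic: "dilog holomorphic_on slit_plane"
  and dilog_sums: "norm z < 1 \<Longrightarrow> (\<lambda>k. z ^ Suc k / of_nat (Suc k) ^ 2) sums dilog z"
  using someI_ex[OF dilog_exists] unfolding dilog_def by auto

lemma dilog_unique:
  assumes "f holomorphic_on slit_plane"
    and "\<And>z. norm z < 1 \<Longrightarrow> (\<lambda>k. z ^ Suc k / of_nat (Suc k) ^ 2) sums f z"
    and z: "z \<in> slit_plane"
  shows "f z = dilog z"
proof (rule analytic_continuation_open[of "ball 0 1" slit_plane f dilog])
  show "connected slit_plane" by (rule starlike_imp_connected[OF starlike_slit_plane])
  show "f y = dilog y" if "y \<in> ball 0 1" for y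
    using that assms(2)[of y] dilog_sums[of y] by (auto intro: sums_unique2)
qed (use assms dilog_holomorphic ball_subset_slit_plane open_slit_plane in auto)

definition catalan :: complex where
  "catalan = (dilog \<i> - dilog (- \<i>)) / (2 * \<i>)"

text \<open>Intended for \<^prop>\<open>1 < Re s\<close> and \<^prop>\<open>- a \<notin> \<nat>\<close>.\<close>

definition hurwitz_zeta :: "complex \<Rightarrow> complex \<Rightarrow> complex" where
  "hurwitz_zeta s a = (\<Sum>k. 1 / (of_nat k + a) powr s)"

text \<open>
  The characteristics of \<open>F\<close>, which depend only on its values on the punctured imaginary axis.
  The integrand is bounded, so the integral exists for every finite measure.
\<close>

definition characteristics ::
    "(complex \<Rightarrow> complex) \<Rightarrow> real \<Rightarrow> real \<Rightarrow> real measure \<Rightarrow> bool" where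
  "characteristics F a b \<rho> \<longleftrightarrow>
     0 \<le> b \<and> finite_measure \<rho> \<and> sets \<rho> = sets borel \<and>
     (\<forall>w::real. w \<noteq> 0 \<longrightarrow>
        F (\<i> * w) = a + \<i> * b * w + (LINT x|\<rho>. (\<i> * w * x - 1) / (\<i> * w + complex_of_real x)))"

end

theory Submission
  imports Defs "HOL-Probability.Probability"
begin

text \<open>
  Put \<open>h x = \<pi>/4 \<cdot> x\<^sup>2 cosh (\<pi>x/2) / sinh\<^sup>2 (\<pi>x/2)\<close> (\<open>cosh_weight\<close>). The measure sought has
  density \<open>h x / (1 + x\<^sup>2)\<close>, and both claims about it reduce to the Fourier transform of \<open>h\<close>,
  which is \<open>H s = 2 / cosh\<^sup>2 s - 2 s sinh s / cosh\<^sup>3 s\<close>, the second derivative of \<open>s tanh s\<close>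
  (\<open>cosh_symbol\<close>). To find \<open>H\<close>, expand \<open>h\<close> into exponentials: its half-line transform becomes
  a series \<open>\<Sum>k. 2 c\<^sub>k / (c\<^sub>k - i s)\<^sup>3\<close> with \<open>c\<^sub>k = (k + 1/2) \<pi>\<close>, a combination of the trigamma
  and tetragamma functions at \<open>1/2 - i s/\<pi>\<close>. Adding the value at \<open>- s\<close>, the reflection
  formulas turn these into hyperbolic functions (\<open>fourier_cosh_weight_symmetric\<close>).

  Since \<open>1 / (w - i x)\<close> is the Laplace transform at \<open>w\<close> of \<open>u \<mapsto> exp (i u x)\<close>, Fubini's theorem
  gives for every finite measure \<open>\<mu>\<close>

    \<open>\<integral> exp (i s x) / (w - i x) d\<mu>(x) = \<integral>\<^sub>0\<^sup>\<infinity> exp (- w u) char \<mu> (s + u) du\<close>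

  (\<open>integral_iexp_resolvent\<close>). This identity is used three times.

  \<^item> For \<open>\<mu> = h dx\<close> and \<open>w = 1\<close>, the factor \<open>1 / (1 + x\<^sup>2)\<close> is the mean of \<open>1 / (1 - i x)\<close> and
    \<open>1 / (1 + i x)\<close>. If \<open>\<Phi>\<close> is the claimed transform, then \<open>\<Phi> - \<Phi>'' = H\<close>, so
    \<open>- exp (- u) (\<Phi> + \<Phi>') (s + u)\<close> is a primitive of \<open>exp (- u) H (s + u)\<close>. It vanishes at infinity
    exactly because \<open>\<integral>\<^sub>0\<^sup>\<infinity> x / cosh x dx\<close> is twice the Catalan constant \<open>K\<close>, and \<open>K\<close> enters \<open>\<Phi>\<close>
    for this reason only.

  \<^item> For \<open>\<mu> = h dx\<close> and \<open>s = 0\<close>, the right-hand side is the Laplace transform of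
    \<open>(u tanh u)''\<close>, that is \<open>w\<^sup>2\<close> times the Laplace transform of \<open>u tanh u\<close>. Expanding
    \<open>tanh\<close> in exponentials yields the Hurwitz zeta values in \<open>V\<close>
    (\<open>integral_laplace_id_tanh\<close>).

  \<^item> For an arbitrary \<open>\<mu>\<close> and \<open>s = 0\<close>, it shows that the resolvent integrals determine the
    Laplace transform of the characteristic function, hence \<open>\<mu>\<close>. With the decomposition
    \<open>(i w x - 1) / (i w + x) = i w - i (w\<^sup>2 - 1) / (w - i x)\<close> of the kernel this proves
    that the characteristics are unique (\<open>characteristics_unique\<close>).
\<close>

section \<open>Termwise Laplace transforms\<close>

lemma set_integral_FTC_Ioi:
  fixes F f :: "real \<Rightarrow> 'a::euclidean_space"
  assumes deriv: "\<And>x. x \<ge> 0 \<Longrightarrow> (F has_vector_derivative f x) (at x)"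
    and cont: "\<And>x. x > 0 \<Longrightarrow> isCont f x"
    and int: "set_integrable lborel {0<..} f"
    and lim: "(F \<longlongrightarrow> L) at_top"
  shows "(LBINT x:{0<..}. f x) = L - F 0"
proof -
  have Ioi: "einterval 0 \<infinity> = {0<..}"
    by (auto simp: einterval_def)
  have "interval_lebesgue_integral lborel 0 \<infinity> f = L - F 0"
  proof (rule interval_integral_FTC_integrable[where F = F])
    have "isCont F 0"
      using deriv[of 0] by (auto intro: has_vector_derivative_continuous)
    then have "(F \<longlongrightarrow> F 0) (at_right 0)"
      by (simp add: continuous_at filterlim_at_split)
    then show "((F \<circ> real_of_ereal) \<longlongrightarrow> F 0) (at_right 0)"
      using ereal_tendsto_simps(2)[of F "F 0" 0] by (simp add: zero_ereal_def)
    show "((F \<circ> real_of_ereal) \<longlongrightarrow> L) (at_left \<infinity>)"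
      using lim by (simp add: ereal_tendsto_simps)
  qed (use deriv cont int in \<open>auto simp: Ioi zero_ereal_def\<close>)
  then show ?thesis
    by (simp add: interval_lebesgue_integral_0_infty)
qed

text \<open>
  The integrand is a multiple of the density of an Erlang distribution, whose mass is \<open>1\<close>.
\<close>

lemma nn_integral_power_mult_exp:
  fixes c :: real
  assumes "c > 0"
  shows "(\<integral>\<^sup>+t. ennreal (indicator {0<..} t * (t ^ m * exp (- (c * t)))) \<partial>lborel) = fact m / c ^ Suc m"
proof -
  have *: "indicator {0<..} t * (t ^ m * exp (- (c * t))) = (fact m / c ^ Suc m) * erlang_density m c t"
    if "t \<noteq> 0" for t
    using assms that by (simp add: erlang_density_def indicator_def)
  have "ennreal (indicator {0<..} t * (t ^ m * exp (- (c * t))))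
      = ennreal (fact m / c ^ Suc m) * ennreal (erlang_density m c t)" if "t \<noteq> 0" for t
    unfolding *[OF that] using assms by (intro ennreal_mult') auto
  then have "(\<integral>\<^sup>+t. ennreal (indicator {0<..} t * (t ^ m * exp (- (c * t)))) \<partial>lborel)
      = (\<integral>\<^sup>+t. ennreal (fact m / c ^ Suc m) * ennreal (erlang_density m c t) \<partial>lborel)"
    using AE_lborel_singleton[of 0] by (intro nn_integral_cong_AE) (auto elim: eventually_mono)
  also have "\<dots> = ennreal (fact m / c ^ Suc m) * (\<integral>\<^sup>+t. ennreal (erlang_density m c t) \<partial>lborel)"
    by (intro nn_integral_cmult) auto
  also have "(\<integral>\<^sup>+t. ennreal (erlang_density m c t) \<partial>lborel) = 1"
    using nn_integral_erlang_ith_moment[of c m 0] assms by simp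
  finally show ?thesis by simp
qed

lemma
  fixes a :: complex
  assumes "Re a > 0"
  shows set_integrable_power_mult_exp:
      "set_integrable lborel {0<..} (\<lambda>t. of_real t ^ m * exp (- (a * of_real t)))"
    and integral_norm_power_mult_exp:
      "(LBINT t:{0<..}. norm (of_real t ^ m * exp (- (a * of_real t)))) = fact m / Re a ^ Suc m"
proof -
  have norm: "norm (indicator {0<..} t *\<^sub>R (of_real t ^ m * exp (- (a * of_real t))))
      = indicator {0<..} t * (t ^ m * exp (- (Re a * t)))" for t :: real
    by (auto simp: indicator_def norm_mult norm_power norm_exp)
  have nn: "(\<integral>\<^sup>+t. ennreal (norm (indicator {0<..} t *\<^sub>R (of_real t ^ m * exp (- (a * of_real t))))) \<partial>lborel)
      = ennreal (fact m / Re a ^ Suc m)"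
    unfolding norm by (rule nn_integral_power_mult_exp[OF assms])
  show int: "set_integrable lborel {0<..} (\<lambda>t. of_real t ^ m * exp (- (a * of_real t)))"
    unfolding set_integrable_def
    by (rule integrableI_bounded) (measurable, simp only: nn ennreal_less_top infinity_ennreal_def)
  have "(LBINT t:{0<..}. norm (of_real t ^ m * exp (- (a * of_real t))))
      = (LINT t|lborel. norm (indicator {0<..} t *\<^sub>R (of_real t ^ m * exp (- (a * of_real t)))))"
    by (simp only: set_lebesgue_integral_def norm_scaleR abs_indicator real_scaleR_def)
  also have "\<dots> = enn2real (\<integral>\<^sup>+t. ennreal (norm (indicator {0<..} t *\<^sub>R (of_real t ^ m * exp (- (a * of_real t))))) \<partial>lborel)"
    by (intro integral_eq_nn_integral AE_I2 norm_ge_zero) measurable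
  also have "\<dots> = fact m / Re a ^ Suc m"
    unfolding nn using assms by (intro enn2real_ennreal) auto
  finally show "(LBINT t:{0<..}. norm (of_real t ^ m * exp (- (a * of_real t)))) = fact m / Re a ^ Suc m" .
qed

lemma tendsto_power_mult_exp_at_top:
  fixes a :: complex
  assumes "Re a > 0"
  shows "((\<lambda>t. of_real t ^ m * exp (- (a * of_real t))) \<longlongrightarrow> 0) at_top"
proof (rule tendsto_norm_zero_cancel)
  have "((\<lambda>t. t ^ m * exp (- (Re a * t))) \<longlongrightarrow> 0) at_top"
  proof -
    have "filterlim (\<lambda>t. Re a * t) at_top at_top"
      using assms by (intro filterlim_tendsto_pos_mult_at_top[OF tendsto_const]) (auto simp: filterlim_ident)
    from tendsto_mult_right_zero[OF filterlim_compose[OF tendsto_power_div_exp_0[of m] this], of "1 / Re a ^ m"]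
    show ?thesis using assms by (simp add: power_mult_distrib exp_minus field_simps)
  qed
  moreover have "eventually (\<lambda>t. norm (of_real t ^ m * exp (- (a * of_real t)))
      = t ^ m * exp (- (Re a * t))) at_top"
    using eventually_ge_at_top[of 0]
    by eventually_elim (simp add: norm_mult norm_power norm_exp)
  ultimately show "((\<lambda>t. norm (of_real t ^ m * exp (- (a * of_real t)))) \<longlongrightarrow> 0) at_top"
    by (subst tendsto_cong)
qed

lemma integral_power_mult_exp:
  fixes a :: complex
  assumes a: "Re a > 0"
  shows "(LBINT t:{0<..}. of_real t ^ m * exp (- (a * of_real t))) = fact m / a ^ Suc m"
proof (induction m)
  have a0: "a \<noteq> 0" using a by auto
  note int = set_integrable_power_mult_exp[OF a]
  note lim = tendsto_power_mult_exp_at_top[OF a]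
  {
    case 0
    have "(LBINT t:{0<..}. - a * exp (- (a * of_real t))) = 0 - exp (- (a * of_real 0))"
    proof (rule set_integral_FTC_Ioi)
      show "set_integrable lborel {0<..} (\<lambda>t. - a * exp (- (a * of_real t)))"
        using int[of 0] by (intro set_integrable_mult_right) simp
      show "((\<lambda>t. exp (- (a * of_real t))) \<longlongrightarrow> 0) at_top"
        using lim[of 0] by simp
      fix t :: real
      show "((\<lambda>t. exp (- (a * of_real t))) has_vector_derivative - a * exp (- (a * of_real t))) (at t)"
        by (rule has_vector_derivative_real_field) (auto intro!: derivative_eq_intros)
    qed auto
    then show ?case using a0 by (simp add: set_integral_mult_right[of lborel _ "- a", simplified] field_simps)
  next
    case (Suc m)
    have "(LBINT t:{0<..}. of_nat (Suc m) * (of_real t ^ m * exp (- (a * of_real t)))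
          - a * (of_real t ^ Suc m * exp (- (a * of_real t))))
        = 0 - of_real 0 ^ Suc m * exp (- (a * of_real 0))"
    proof (rule set_integral_FTC_Ioi)
      fix x :: real
      show "((\<lambda>t. of_real t ^ Suc m * exp (- (a * of_real t))) has_vector_derivative
          of_nat (Suc m) * (of_real x ^ m * exp (- (a * of_real x)))
            - a * (of_real x ^ Suc m * exp (- (a * of_real x)))) (at x)"
        by (rule has_vector_derivative_real_field)
           (rule derivative_eq_intros refl | simp add: algebra_simps)+
    next
      show "set_integrable lborel {0<..} (\<lambda>t. of_nat (Suc m) * (of_real t ^ m * exp (- (a * of_real t)))
            - a * (of_real t ^ Suc m * exp (- (a * of_real t))))"
        by (intro set_integral_diff set_integrable_mult_right int)
      show "((\<lambda>t. of_real t ^ Suc m * exp (- (a * of_real t))) \<longlongrightarrow> 0) at_top"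
        by (rule lim)
    qed (intro continuous_intros)
    moreover have "(LBINT t:{0<..}. of_nat (Suc m) * (of_real t ^ m * exp (- (a * of_real t)))
          - a * (of_real t ^ Suc m * exp (- (a * of_real t))))
        = of_nat (Suc m) * (LBINT t:{0<..}. of_real t ^ m * exp (- (a * of_real t)))
          - a * (LBINT t:{0<..}. of_real t ^ Suc m * exp (- (a * of_real t)))"
      by (subst set_integral_diff(2))
         (intro set_integrable_mult_right int, intro set_integrable_mult_right int,
          simp only: set_integral_mult_right)
    ultimately have "a * (LBINT t:{0<..}. of_real t ^ Suc m * exp (- (a * of_real t)))
        = of_nat (Suc m) * (fact m / a ^ Suc m)"
      using Suc.IH by (simp del: of_nat_Suc)
    then have "(LBINT t:{0<..}. of_real t ^ Suc m * exp (- (a * of_real t)))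
        = of_nat (Suc m) * (fact m / a ^ Suc m) / a"
      using a0 by (metis nonzero_mult_div_cancel_left)
    also have "\<dots> = fact (Suc m) / a ^ Suc (Suc m)"
      by (simp only: fact_Suc power_Suc times_divide_eq_right divide_divide_eq_left mult_ac)
    finally show ?case .
  }
qed

text \<open>
  Fubini for series. The exponents may be complex, which turns Fourier transforms on the
  half-line into Laplace transforms, and the coefficients may alternate in sign; so the same
  lemma serves \<open>cosh_weight\<close>, \<open>x / cosh x\<close> and the Hurwitz zeta function.
\<close>

lemma termwise_laplace:
  fixes a b :: "nat \<Rightarrow> complex" and g :: "real \<Rightarrow> complex"
  assumes a: "\<And>k. Re (a k) > 0"
    and summable: "summable (\<lambda>k. norm (b k) / Re (a k) ^ Suc m)"
    and g: "\<And>t. t > 0 \<Longrightarrow> (\<lambda>k. b k * exp (- (a k * of_real t))) sums g t"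
  shows set_integrable_termwise_laplace: "set_integrable lborel {0<..} (\<lambda>t. of_real t ^ m * g t)"
    and sums_termwise_laplace:
      "(\<lambda>k. b k * fact m / a k ^ Suc m) sums (LBINT t:{0<..}. of_real t ^ m * g t)"
proof -
  define f where "f k t = indicator {0<..} t *\<^sub>R (b k * (of_real t ^ m * exp (- (a k * of_real t))))"
    for k and t :: real
  have int: "integrable lborel (f k)" for k
    using set_integrable_mult_right[OF set_integrable_power_mult_exp[OF a[of k], of m], of "b k"]
    by (simp add: set_integrable_def f_def[abs_def])
  have norm_f: "norm (f k t) = norm (b k) *
      (indicator {0<..} t *\<^sub>R norm (of_real t ^ m * exp (- (a k * of_real t))))" for k t
    by (simp add: f_def norm_mult)
  have int_norm: "(LINT t|lborel. norm (f k t)) = fact m * (norm (b k) / Re (a k) ^ Suc m)" for k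
    unfolding norm_f using integral_norm_power_mult_exp[OF a[of k], of m]
    by (simp add: set_lebesgue_integral_def)
  have sum_norm: "summable (\<lambda>k. LINT t|lborel. norm (f k t))"
    unfolding int_norm by (rule summable_mult[OF summable])
  have "(\<integral>\<^sup>+t. (\<Sum>k. ennreal (norm (f k t))) \<partial>lborel) = (\<Sum>k. ennreal (LINT t|lborel. norm (f k t)))"
    using int by (subst nn_integral_suminf)
      (auto intro!: arg_cong[where f = suminf] nn_integral_eq_integral integrable_norm)
  also have "\<dots> \<noteq> \<infinity>"
    using sum_norm by (simp add: ennreal_suminf_neq_top integral_nonneg_AE)
  \<comment> \<open>The absolute pointwise convergence comes for free from the convergence of the integrals.\<close>
  finally have "AE t in lborel. (\<Sum>k. ennreal (norm (f k t))) \<noteq> \<infinity>"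
    using int by (intro nn_integral_noteq_infinite) auto
  then have AE: "AE t in lborel. summable (\<lambda>k. norm (f k t))"
    by eventually_elim (auto intro: summable_suminf_not_top)
  have eq: "(\<Sum>k. f k t) = indicator {0<..} t *\<^sub>R (of_real t ^ m * g t)" for t
  proof (cases "t > 0")
    case True
    from sums_mult[OF g[OF True], of "of_real t ^ m"] show ?thesis
      using True by (simp add: f_def sums_iff mult_ac)
  qed (simp add: f_def)
  show "set_integrable lborel {0<..} (\<lambda>t. of_real t ^ m * g t)"
    using integrable_suminf[OF int AE sum_norm] by (simp add: eq set_integrable_def)
  have integral_f: "integral\<^sup>L lborel (f k) = b k * fact m / a k ^ Suc m" for k
    using integral_power_mult_exp[OF a[of k], of m]
    by (simp add: f_def[abs_def] set_lebesgue_integral_def[symmetric])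
  show "(\<lambda>k. b k * fact m / a k ^ Suc m) sums (LBINT t:{0<..}. of_real t ^ m * g t)"
    using sums_integral[OF int AE sum_norm] unfolding eq integral_f set_lebesgue_integral_def .
qed

section \<open>Injectivity of the Laplace transform\<close>

lemma
  fixes f :: "'i \<Rightarrow> 'a \<Rightarrow> 'b::{banach, second_countable_topology}"
  assumes "\<And>i. i \<in> I \<Longrightarrow> set_integrable M A (f i)"
  shows set_integrable_sum: "set_integrable M A (\<lambda>x. \<Sum>i\<in>I. f i x)"
    and set_integral_sum: "(LINT x:A|M. (\<Sum>i\<in>I. f i x)) = (\<Sum>i\<in>I. LINT x:A|M. f i x)"
  using assms unfolding set_integrable_def set_lebesgue_integral_def scaleR_sum_right
  by (auto intro!: Bochner_Integration.integral_sum)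

lemma
  fixes c :: real
  assumes c: "c > 0"
  shows set_integrable_exp: "set_integrable lborel {0<..} (\<lambda>t. exp (- (c * t)))"
    and integral_exp: "(LBINT t:{0<..}. exp (- (c * t))) = 1 / c"
proof -
  have "set_integrable lborel {0<..} (\<lambda>t. norm (of_real t ^ 0 * exp (- (of_real c * of_real t :: complex))))"
    using c by (intro set_integrable_norm set_integrable_power_mult_exp) simp
  then show "set_integrable lborel {0<..} (\<lambda>t. exp (- (c * t)))" by simp
  show "(LBINT t:{0<..}. exp (- (c * t))) = 1 / c"
    using integral_norm_power_mult_exp[of "of_real c" 0] c by simp
qed

lemma set_integrable_exp_scaleR:
  fixes g :: "real \<Rightarrow> 'a::{banach, second_countable_topology}"
  assumes "c > 0" and meas: "set_borel_measurable borel {0<..} g"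
    and bound: "\<And>t. t > 0 \<Longrightarrow> norm (g t) \<le> C"
  shows "set_integrable lborel {0<..} (\<lambda>t. exp (- (c * t)) *\<^sub>R g t)"
proof (rule set_integrable_bound[where f = "\<lambda>t. C * exp (- (c * t))"])
  show "set_integrable lborel {0<..} (\<lambda>t. C * exp (- (c * t)))"
    by (intro set_integrable_mult_right set_integrable_exp assms)
  have eq: "(\<lambda>t. indicator {0<..} t *\<^sub>R (exp (- (c * t)) *\<^sub>R g t)) = (\<lambda>t. exp (- (c * t)) *\<^sub>R (indicator {0<..} t *\<^sub>R g t))"
    by (simp add: mult.commute)
  show "set_borel_measurable lborel {0<..} (\<lambda>t. exp (- (c * t)) *\<^sub>R g t)"
    using meas unfolding set_borel_measurable_def eq by measurable
  show "AE t in lborel. t \<in> {0<..} \<longrightarrow> norm (exp (- (c * t)) *\<^sub>R g t) \<le> norm (C * exp (- (c * t)))"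
  proof (intro AE_I2 impI)
    fix t :: real assume "t \<in> {0<..}"
    then have "norm (g t) \<le> \<bar>C\<bar>" using bound[of t] by auto
    then show "norm (exp (- (c * t)) *\<^sub>R g t) \<le> norm (C * exp (- (c * t)))"
      by (simp add: abs_mult mult.commute mult_right_mono)
  qed
qed

text \<open>
  Lerch's theorem for integer arguments. In the variable \<open>u = exp (- t)\<close> the hypothesis says
  that all moments from some order on vanish. So, for the integrable weight
  \<open>exp (- 2 t)\<close>, the function \<open>f\<close> is orthogonal to every polynomial in \<open>exp (- t)\<close>. Approximating
  \<open>exp (- t) f t\<close> by such polynomials gives \<open>\<integral> exp (- 3 t) (f t)\<^sup>2 dt = 0\<close>; here the factor
  \<open>exp (- t)\<close> makes the approximated function continuous at \<open>u = 0\<close>.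
\<close>

lemma laplace_zero_imp_zero_real:
  fixes f :: "real \<Rightarrow> real"
  assumes cont: "continuous_on {0..} f"
    and bound: "\<And>t. t \<ge> 0 \<Longrightarrow> \<bar>f t\<bar> \<le> B"
    and zero: "\<And>n::nat. n \<ge> 2 \<Longrightarrow> (LBINT t:{0<..}. exp (- (real n * t)) * f t) = 0"
    and t: "t > 0"
  shows "f t = 0"
proof -
  have B: "B \<ge> 0" using bound[of 0] by simp
  have meas [measurable]: "set_borel_measurable borel {0<..} f"
    by (rule borel_measurable_continuous_on_indicator[folded set_borel_measurable_def, simplified])
       (auto intro: continuous_on_subset[OF cont])
  note int = set_integrable_exp_scaleR[where 'a = real, simplified]
  have sq_meas: "set_borel_measurable borel {0<..} (\<lambda>t. f t * f t)"
  proof -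
    have "(\<lambda>t. indicator {0<..} t *\<^sub>R (f t * f t)) = (\<lambda>t. (indicator {0<..} t *\<^sub>R f t) * (indicator {0<..} t *\<^sub>R f t))"
      by (auto simp: indicator_def)
    then show ?thesis using meas unfolding set_borel_measurable_def by simp
  qed
  \<comment> \<open>The function \<open>exp (- t) f t\<close> in the variable \<open>u = exp (- t)\<close>, extended by its limit at infinity.\<close>
  define k where "k u = (if u = 0 then 0 else u * f (- ln u))" for u
  have k_exp: "k (exp (- t)) = exp (- t) * f t" for t by (simp add: k_def)
  have cont_k: "continuous_on {0..1} k"
    unfolding continuous_on_def
  proof
    fix u :: real assume u: "u \<in> {0..1}"
    show "(k \<longlongrightarrow> k u) (at u within {0..1})"
    proof (cases "u = 0")
      case True
      have "((\<lambda>u. B * \<bar>u\<bar>) \<longlongrightarrow> B * \<bar>0\<bar>) (at 0 within {0..1})" by (intro tendsto_intros)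
      moreover have "eventually (\<lambda>u. norm (k u) \<le> B * \<bar>u\<bar>) (at 0 within {0..1})"
        unfolding eventually_at_filter
      proof (intro always_eventually allI impI)
        fix u :: real assume "u \<noteq> 0" "u \<in> {0..1}"
        then show "norm (k u) \<le> B * \<bar>u\<bar>"
          using bound[of "- ln u"] by (simp add: k_def abs_mult mult.commute mult_right_mono)
      qed
      ultimately have "(k \<longlongrightarrow> 0) (at 0 within {0..1})"
        by (intro Lim_null_comparison[of k "\<lambda>u. B * \<bar>u\<bar>"]) auto
      then show ?thesis using True by (simp add: k_def)
    next
      case False
      then have u0: "u > 0" using u by simp
      have "continuous_on {0<..1} (\<lambda>u. u * f (- ln u))"
        by (intro continuous_intros continuous_on_compose2[OF cont]) auto
      then have "((\<lambda>u. u * f (- ln u)) \<longlongrightarrow> u * f (- ln u)) (at u within {0<..1})"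
        using u0 u by (auto simp: continuous_on_def)
      moreover have "at u within {0<..1} = at u within {0..1}"
        by (rule at_within_nhd[where S = "{0<..}"]) (use u0 in auto)
      moreover have "eventually (\<lambda>u. u * f (- ln u) = k u) (at u within {0..1})"
        using eventually_at_in_open'[of "{0<..}" u] u0
        by (intro filter_leD[OF at_le[of "{0..1}" UNIV u]]) (auto elim!: eventually_mono simp: k_def)
      ultimately show ?thesis
        using u0 by (auto simp: k_def intro: Lim_transform_eventually)
    qed
  qed
  define I where "I = (LBINT t:{0<..}. exp (- (3 * t)) * (f t * f t))"
  have sq_bound: "\<bar>f t * f t\<bar> \<le> B * B" if "t > 0" for t
    unfolding abs_mult using bound[of t] B that by (intro mult_mono) auto
  have I_int: "set_integrable lborel {0<..} (\<lambda>t. exp (- (3 * t)) * (f t * f t))"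
    by (rule int[where C = "B * B", OF _ sq_meas]) (use sq_bound in auto)
  have small: "I \<le> e * B" if e: "e > 0" for e
  proof -
    obtain g where g: "real_polynomial_function g" "\<And>u. u \<in> {0..1} \<Longrightarrow> \<bar>k u - g u\<bar> < e"
      using Stone_Weierstrass_real_polynomial_function[OF compact_Icc cont_k e] by blast
    then obtain a n where gsum: "g = (\<lambda>u. \<Sum>i\<le>n. a i * u ^ i)"
      by (auto simp: real_polynomial_function_iff_sum)
    have term_eq: "exp (- (2 * t)) * (exp (- t) ^ i * f t) = exp (- (real (i + 2) * t)) * f t" for i t
      by (simp add: exp_of_nat_mult[symmetric] exp_add[symmetric] algebra_simps)
    have term_int: "set_integrable lborel {0<..} (\<lambda>t. exp (- (real (i + 2) * t)) * f t)" for i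
      by (rule int[OF _ meas, where C = B]) (use bound in auto)
    have g_eq: "exp (- (2 * t)) * (g (exp (- t)) * f t) = (\<Sum>i\<le>n. a i * (exp (- (real (i + 2) * t)) * f t))" for t
      unfolding gsum term_eq[symmetric] by (simp add: sum_distrib_left sum_distrib_right mult_ac)
    have g_int: "set_integrable lborel {0<..} (\<lambda>t. exp (- (2 * t)) * (g (exp (- t)) * f t))"
      unfolding g_eq by (intro set_integrable_sum set_integrable_mult_right term_int)
    have g_zero: "(LBINT t:{0<..}. exp (- (2 * t)) * (g (exp (- t)) * f t)) = 0"
    proof -
      have "(LBINT t:{0<..}. exp (- (2 * t)) * (g (exp (- t)) * f t))
          = (\<Sum>i\<le>n. a i * (LBINT t:{0<..}. exp (- (real (i + 2) * t)) * f t))"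
        unfolding g_eq by (subst set_integral_sum)
          (intro set_integrable_mult_right term_int, simp only: set_integral_mult_right)
      also have "\<dots> = 0"
        by (intro sum.neutral ballI, subst zero) auto
      finally show ?thesis .
    qed
    have I_eq: "exp (- (3 * t)) * (f t * f t) = exp (- (2 * t)) * (k (exp (- t)) * f t)" for t
    proof -
      have "exp (- (3 * t)) = exp (- (2 * t)) * exp (- t)" by (simp add: exp_add[symmetric])
      then show ?thesis by (simp add: k_exp)
    qed
    have "I = (LBINT t:{0<..}. exp (- (2 * t)) * (k (exp (- t)) * f t)) - (LBINT t:{0<..}. exp (- (2 * t)) * (g (exp (- t)) * f t))"
      by (simp add: I_def I_eq g_zero)
    also have "\<dots> = (LBINT t:{0<..}. exp (- (2 * t)) * (k (exp (- t)) * f t) - exp (- (2 * t)) * (g (exp (- t)) * f t))"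
      using I_int g_int by (subst set_integral_diff) (auto simp: I_eq)
    also have "\<dots> \<le> (LBINT t:{0<..}. e * B * exp (- (2 * t)))"
    proof (rule set_integral_mono)
      show "set_integrable lborel {0<..} (\<lambda>t. exp (- (2 * t)) * (k (exp (- t)) * f t) - exp (- (2 * t)) * (g (exp (- t)) * f t))"
        using I_int g_int by (intro set_integral_diff) (auto simp: I_eq)
      show "set_integrable lborel {0<..} (\<lambda>t. e * B * exp (- (2 * t)))"
        by (intro set_integrable_mult_right set_integrable_exp) auto
      fix t :: real assume t: "t \<in> {0<..}"
      have "(k (exp (- t)) - g (exp (- t))) * f t \<le> \<bar>k (exp (- t)) - g (exp (- t))\<bar> * \<bar>f t\<bar>"
        by (simp add: abs_mult[symmetric])
      also have "\<dots> \<le> e * B"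
        using g(2)[of "exp (- t)"] bound[of t] t by (intro mult_mono) auto
      finally show "exp (- (2 * t)) * (k (exp (- t)) * f t) - exp (- (2 * t)) * (g (exp (- t)) * f t) \<le> e * B * exp (- (2 * t))"
        by (simp add: right_diff_distrib[symmetric] left_diff_distrib[symmetric] mult.commute)
    qed
    also have "\<dots> = e * B / 2"
      using integral_exp[of 2] by (subst set_integral_mult_right) auto
    also have "\<dots> \<le> e * B"
      using e B by simp
    finally show ?thesis .
  qed
  have "I \<le> 0"
  proof (rule field_le_epsilon)
    fix d :: real assume "d > 0"
    then have "I \<le> d / (B + 1) * B" using B by (intro small) auto
    also have "\<dots> \<le> d" using B \<open>d > 0\<close> by (simp add: field_simps)
    finally show "I \<le> 0 + d" by simp
  qed
  moreover have "I \<ge> 0" unfolding I_def set_lebesgue_integral_def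
    by (intro Bochner_Integration.integral_nonneg) (auto simp: indicator_def)
  ultimately have "I = 0" by simp
  then have "AE t in lborel. indicator {0<..} t *\<^sub>R (exp (- (3 * t)) * (f t * f t)) = 0"
    using I_int unfolding I_def set_lebesgue_integral_def set_integrable_def
    by (subst (asm) integral_nonneg_eq_0_iff_AE) (auto simp: indicator_def)
  then have "AE t\<in>{0<..} in lborel. f t = 0"
    by eventually_elim (auto simp: indicator_def)
  then have AE: "AE t\<in>{0<..} in lebesgue. t \<in> {t\<in>{0..}. f t = 0}"
    using AE_completion by (auto elim!: eventually_mono)
  have "closed {t\<in>{0..}. f t = 0}"
    using continuous_closed_preimage_constant[OF cont, of 0]
    by (simp add: vimage_def Int_def conj_commute)
  \<comment> \<open>By continuity, a function that vanishes almost everywhere on an open set vanishes on it.\<close>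
  from mem_closed_if_AE_lebesgue_open[OF _ this AE] t show ?thesis by auto
qed

lemma laplace_zero_imp_zero:
  fixes f :: "real \<Rightarrow> complex"
  assumes cont: "continuous_on {0..} f"
    and bound: "\<And>t. t \<ge> 0 \<Longrightarrow> norm (f t) \<le> B"
    and zero: "\<And>n::nat. n \<ge> 2 \<Longrightarrow> (LBINT t:{0<..}. exp (- (real n * t)) *\<^sub>R f t) = 0"
    and t: "t \<ge> 0"
  shows "f t = 0"
proof -
  have meas: "set_borel_measurable borel {0<..} f"
    by (rule set_measurable_continuous_on) (auto intro: continuous_on_subset[OF cont])
  have int: "integrable lborel (\<lambda>t. indicator {0<..} t *\<^sub>R (exp (- (real n * t)) *\<^sub>R f t))" if "n \<ge> 2" for n
    using set_integrable_exp_scaleR[OF _ meas, of "real n" B] bound that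
    by (simp add: set_integrable_def)
  have zeros: "(LBINT t:{0<..}. exp (- (real n * t)) * Re (f t)) = 0"
    "(LBINT t:{0<..}. exp (- (real n * t)) * Im (f t)) = 0" if n: "n \<ge> 2" for n
    using integral_Re[OF int[OF n]] integral_Im[OF int[OF n]] zero[OF n]
    by (simp_all add: set_lebesgue_integral_def mult.assoc)
  have pos: "f t = 0" if "t > 0" for t
  proof (rule complex_eqI)
    show "Re (f t) = Re 0"
      using laplace_zero_imp_zero_real[of "\<lambda>t. Re (f t)" B t] cont bound zeros that
      by (auto intro!: continuous_intros intro: order_trans[OF abs_Re_le_cmod])
    show "Im (f t) = Im 0"
      using laplace_zero_imp_zero_real[of "\<lambda>t. Im (f t)" B t] cont bound zeros that
      by (auto intro!: continuous_intros intro: order_trans[OF abs_Im_le_cmod])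
  qed
  show ?thesis
    by (rule continuous_constant_on_closure[of "{0<..}" f]) (use cont pos t in auto)
qed

section \<open>Uniqueness of the characteristics\<close>

lemma norm_char_le_measure:
  assumes "finite_measure M" and sets: "sets M = sets borel"
  shows "norm (char M t) \<le> measure M UNIV"
proof -
  have "space M = UNIV" using sets[THEN sets_eq_imp_space_eq] by simp
  have "norm (char M t) \<le> (\<integral>x. norm (iexp (t * x)) \<partial>M)"
    unfolding char_def by (rule integral_norm_bound)
  then show ?thesis by (simp add: \<open>space M = UNIV\<close>)
qed

lemma continuous_on_char:
  assumes "finite_measure M" and [measurable_cong]: "sets M = sets borel"
  shows "continuous_on A (char M)"
proof (rule continuous_at_imp_continuous_on, rule ballI)
  interpret finite_measure M by fact
  fix t
  show "isCont (char M) t"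
    unfolding continuous_at_sequentially
  proof safe
    fix X assume X: "X \<longlonglongrightarrow> t"
    show "(char M \<circ> X) \<longlonglongrightarrow> char M t"
      unfolding comp_def char_def
      by (rule integral_dominated_convergence[where w = "\<lambda>_. 1"]) (auto intro!: tendsto_intros X)
  qed
qed

text \<open>
  Reduction to probability measures: both measures have the same mass \<open>char M 0\<close>, and they are
  divided by it unless it is zero.
\<close>

lemma finite_measure_char_unique:
  assumes fin: "finite_measure M" "finite_measure N"
    and sets: "sets M = sets borel" "sets N = sets borel"
    and char: "char M = char N"
  shows "M = N"
proof -
  interpret M: finite_measure M by fact
  interpret N: finite_measure N by fact
  have space: "space M = UNIV" "space N = UNIV"
    using sets[THEN sets_eq_imp_space_eq] by simp_all
  have c0: "char M 0 = of_real (measure M UNIV)" "char N 0 = of_real (measure N UNIV)"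
    by (simp_all add: char_def space scaleR_conv_of_real)
  define c where "c = measure M UNIV"
  have c: "measure M UNIV = c" "measure N UNIV = c"
    using c0 char by (simp_all add: c_def)
  show ?thesis
  proof (cases "c = 0")
    case True
    have "emeasure M A = 0" for A
      using emeasure_mono[of A UNIV M] c(1) True space sets by (auto simp: M.emeasure_eq_measure)
    moreover have "emeasure N A = 0" for A
      using emeasure_mono[of A UNIV N] c(2) True space sets by (auto simp: N.emeasure_eq_measure)
    ultimately show ?thesis using sets by (intro measure_eqI) auto
  next
    case False
    then have c_pos: "c > 0" using c measure_nonneg[of M UNIV] by simp
    define norm where "norm L = density L (\<lambda>_. ennreal (1 / c))" for L :: "real measure"
    have dist: "real_distribution (norm L)"
      if "finite_measure L" "sets L = sets borel" "measure L UNIV = c" for L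
    proof -
      interpret L: finite_measure L by fact
      have "space L = UNIV" using that(2)[THEN sets_eq_imp_space_eq] by simp
      then have "emeasure (norm L) (space (norm L)) = 1"
        using c_pos that
        by (simp add: norm_def emeasure_density_const L.emeasure_eq_measure ennreal_mult[symmetric])
      then show ?thesis
        using that(2) by (intro real_distribution.intro prob_spaceI real_distribution_axioms.intro) (auto simp: norm_def)
    qed
    have char_norm: "char (norm L) t = (1 / c) *\<^sub>R char L t" if "sets L = sets borel" for L t
      using c_pos that unfolding char_def norm_def
      by (subst integral_density) (auto simp: measurable_cong_sets[OF that refl])
    have "norm M = norm N"
      by (rule Levy_uniqueness) (use dist fin sets c char_norm char in \<open>auto simp: fun_eq_iff\<close>)
    moreover have "emeasure L A = ennreal c * emeasure (norm L) A" if "A \<in> sets L" for L A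
      using that c_pos
      by (simp add: norm_def emeasure_density_const mult.assoc[symmetric] ennreal_mult[symmetric])
    ultimately show ?thesis using sets by (intro measure_eqI) auto
  qed
qed

text \<open>
  The bridge between resolvent integrals and characteristic functions. The shift by \<open>s\<close> is
  carried along because the Fourier transform of a density divided by \<open>1 + x\<^sup>2\<close> is an average
  of such integrals.
\<close>

lemma integral_iexp_resolvent:
  fixes w :: real
  assumes fin: "finite_measure M" and sets [measurable_cong]: "sets M = sets borel" and w: "w > 0"
  shows "(LINT x|M. iexp (s * x) / (w - \<i> * x)) = (LBINT u:{0<..}. exp (- (w * u)) *\<^sub>R char M (s + u))"
proof -
  interpret M: finite_measure M by fact
  interpret P: pair_sigma_finite M lborel
    by (intro pair_sigma_finite.intro M.sigma_finite_measure_axioms lborel.sigma_finite_measure_axioms)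
  define f where "f x u = indicator {0<..} u *\<^sub>R (exp (- (w * u)) *\<^sub>R iexp ((s + u) * x))" for x u :: real
  have [measurable]: "case_prod f \<in> borel_measurable (M \<Otimes>\<^sub>M lborel)"
    unfolding f_def by measurable
  have norm_f: "norm (f x u) = indicator {0<..} u *\<^sub>R exp (- (w * u))" for x u
    by (simp add: f_def)
  have "integrable lborel (\<lambda>u. norm (f x u))" for x
    using set_integrable_exp[OF w] by (simp add: norm_f set_integrable_def)
  then have int_f: "integrable lborel (f x)" for x
    by (rule integrable_norm_cancel) (simp add: f_def)
  have int: "integrable (M \<Otimes>\<^sub>M lborel) (case_prod f)"
    by (rule P.Fubini_integrable) (simp_all add: int_f norm_f)
  have "(LBINT u:{0<..}. exp (- (w * u)) *\<^sub>R char M (s + u)) = (\<integral>u. (\<integral>x. f x u \<partial>M) \<partial>lborel)"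
    by (simp add: set_lebesgue_integral_def f_def char_def)
  also have "\<dots> = (\<integral>x. (\<integral>u. f x u \<partial>lborel) \<partial>M)"
    by (rule P.Fubini_integral[OF int])
  also have "\<dots> = (LINT x|M. iexp (s * x) / (w - \<i> * x))"
  proof (rule Bochner_Integration.integral_cong[OF refl])
    fix x :: real
    have "f x u = iexp (s * x) * (indicator {0<..} u *\<^sub>R (of_real u ^ 0 * exp (- ((w - \<i> * x) * of_real u))))" for u
      by (simp add: f_def indicator_def scaleR_conv_of_real exp_of_real[symmetric] exp_add[symmetric] algebra_simps
          del: exp_of_real)
    then have "(\<integral>u. f x u \<partial>lborel) = iexp (s * x) * (LBINT u:{0<..}. of_real u ^ 0 * exp (- ((w - \<i> * x) * of_real u)))"
      by (simp only: set_lebesgue_integral_def integral_mult_right_zero)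
    also have "\<dots> = iexp (s * x) / (w - \<i> * x)"
      using w by (subst integral_power_mult_exp) auto
    finally show "(\<integral>u. f x u \<partial>lborel) = iexp (s * x) / (w - \<i> * x)" .
  qed
  finally show ?thesis by simp
qed

text \<open>
  Only arguments \<open>w > 1\<close> are demanded, since the kernel of the characteristics loses its
  dependence on \<open>x\<close> at \<open>w = 1\<close>.
\<close>

lemma resolvent_unique:
  fixes M N :: "real measure"
  assumes fin: "finite_measure M" "finite_measure N"
    and sets: "sets M = sets borel" "sets N = sets borel"
    and eq: "\<And>w::real. (1::real) < w \<Longrightarrow> (LINT x|M. 1 / (w - \<i> * x)) = (LINT x|N. 1 / (w - \<i> * x))"
  shows "M = N"
proof (rule finite_measure_char_unique[OF fin sets], rule ext)
  have nonneg: "char M t = char N t" if t: "t \<ge> 0" for t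
  proof -
    have cont: "continuous_on {0..} (char M)" "continuous_on {0..} (char N)"
      using fin sets by (auto intro: continuous_on_char)
    have bound: "norm (char M t - char N t) \<le> measure M UNIV + measure N UNIV" for t
      using norm_char_le_measure[OF fin(1) sets(1), of t] norm_char_le_measure[OF fin(2) sets(2), of t]
        norm_triangle_ineq4[of "char M t" "char N t"] by linarith
    have int: "set_integrable lborel {0<..} (\<lambda>t. exp (- (real n * t)) *\<^sub>R char L t)"
      if "n \<ge> 2" "finite_measure L" "sets L = sets borel" for n :: nat and L
    proof (rule set_integrable_exp_scaleR)
      show "set_borel_measurable borel {0<..} (char L)"
        by (intro set_measurable_continuous_on continuous_on_char that) simp
      show "norm (char L t) \<le> measure L UNIV" for t
        by (intro norm_char_le_measure that)
    qed (use that in simp)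
    have "(LBINT t:{0<..}. exp (- (real n * t)) *\<^sub>R (char M t - char N t)) = 0" if n: "n \<ge> 2" for n :: nat
    proof -
      have "(LBINT t:{0<..}. exp (- (real n * t)) *\<^sub>R (char M t - char N t))
          = (LBINT t:{0<..}. exp (- (real n * t)) *\<^sub>R char M t) - (LBINT t:{0<..}. exp (- (real n * t)) *\<^sub>R char N t)"
        unfolding scaleR_diff_right using n fin sets by (intro set_integral_diff int)
      also have "\<dots> = 0"
        using integral_iexp_resolvent[OF fin(1) sets(1), of "real n" 0]
          integral_iexp_resolvent[OF fin(2) sets(2), of "real n" 0] eq[of "real n"] n by simp
      finally show ?thesis .
    qed
    then have "char M t - char N t = 0"
      by (intro laplace_zero_imp_zero[OF continuous_on_diff[OF cont] bound _ t])
    then show ?thesis by simp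
  qed
  have minus: "char L (- t) = cnj (char L t)" for L t
    by (simp add: char_def Bochner_Integration.integral_cnj[symmetric] exp_cnj)
  fix t
  show "char M t = char N t"
    using nonneg[of t] nonneg[of "- t"] minus[of M "- t"] minus[of N "- t"] by (cases "t \<ge> 0") auto
qed

text \<open>
  The first summand does not involve \<open>x\<close>. Hence the value at \<open>w = 1\<close> isolates \<open>a\<close> and
  \<open>b + \<rho>(\<real>)\<close>, while the values at \<open>w > 1\<close> give the resolvent integrals of \<open>\<rho>\<close>.
\<close>

lemma characteristics_kernel_eq:
  fixes w x :: real
  assumes "w \<noteq> 0"
  shows "(\<i> * w * x - 1) / (\<i> * w + complex_of_real x)
      = \<i> * w + (w\<^sup>2 - 1) * (- \<i>) * (1 / (w - \<i> * x))"
proof -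
  have 1: "\<i> * w + complex_of_real x \<noteq> 0" "w - \<i> * x \<noteq> 0"
    using assms by (auto simp: complex_eq_iff)
  then show ?thesis by (simp add: field_simps power2_eq_square)
qed

lemma characteristics_unique:
  assumes char: "characteristics F a b M" "characteristics F a' b' N"
  shows "a = a' \<and> b = b' \<and> M = N"
proof -
  have expand: "F (\<i> * w) = a + \<i> * w * (b + measure M UNIV) + (w\<^sup>2 - 1) * (- \<i>) * (LINT x|M. 1 / (w - \<i> * x))"
    if "characteristics F a b M" "w > 0" for a b M and w :: real
  proof -
    from that have fin: "finite_measure M" and sets [measurable_cong]: "sets M = sets borel"
      by (simp_all add: characteristics_def)
    have space: "space M = UNIV" using sets[THEN sets_eq_imp_space_eq] by simp
    have "integrable M (\<lambda>x. 1 / (w - \<i> * x))"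
    proof (rule finite_measure.integrable_const_bound[OF fin, where B = "1 / w"])
      have "w \<le> norm (w - \<i> * x)" for x :: real
        using abs_Re_le_cmod[of "w - \<i> * x"] by simp
      then show "AE x in M. norm (1 / (w - \<i> * x)) \<le> 1 / w"
        using that(2) by (auto simp: norm_divide intro!: divide_left_mono)
    qed simp
    then have "(LINT x|M. \<i> * w + (w\<^sup>2 - 1) * (- \<i>) * (1 / (w - \<i> * x)))
        = (LINT x|M. \<i> * w) + (w\<^sup>2 - 1) * (- \<i>) * (LINT x|M. 1 / (w - \<i> * x))"
      using fin by (subst Bochner_Integration.integral_add)
        (auto simp only: finite_measure.integrable_const integral_mult_right_zero
          intro!: integrable_mult_right)
    then have "(LINT x|M. (\<i> * w * x - 1) / (\<i> * w + complex_of_real x))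
        = \<i> * w * measure M UNIV + (w\<^sup>2 - 1) * (- \<i>) * (LINT x|M. 1 / (w - \<i> * x))"
      using that(2) by (subst characteristics_kernel_eq) (simp_all add: space scaleR_conv_of_real mult_ac)
    then show ?thesis using that by (simp add: characteristics_def algebra_simps)
  qed
  have at_1: "a + \<i> * (b + measure M UNIV) = a' + \<i> * (b' + measure N UNIV)"
    using expand[OF char(1), of 1] expand[OF char(2), of 1] by simp
  then have a: "a = a'" and b: "b + measure M UNIV = b' + measure N UNIV"
    by (simp_all add: complex_eq_iff)
  have "M = N"
  proof (rule resolvent_unique)
    fix w :: real assume w: "w > 1"
    then have "w\<^sup>2 \<noteq> 1" by (simp add: power2_eq_1_iff)
    then have "complex_of_real (w\<^sup>2 - 1) \<noteq> 0" by (simp del: of_real_diff)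
    then show "(LINT x|M. 1 / (w - \<i> * x)) = (LINT x|N. 1 / (w - \<i> * x))"
      using expand[OF char(1), of w] expand[OF char(2), of w] w a b
      by simp
  qed (use char in \<open>auto simp: characteristics_def\<close>)
  then show ?thesis using a b by simp
qed

section \<open>Reflection formulas for polygamma functions\<close>

text \<open>
  The logarithmic derivative of the reflection formula for the Gamma function.
\<close>

lemma Digamma_reflection:
  fixes z :: complex
  assumes z: "z \<notin> \<int>"
  shows "Digamma z - Digamma (1 - z) = - (of_real pi * cos (of_real pi * z) / sin (of_real pi * z))"
proof -
  have nz: "z \<notin> \<int>\<^sub>\<le>\<^sub>0" "1 - z \<notin> \<int>\<^sub>\<le>\<^sub>0"
    using z nonpos_Ints_Int Ints_diff[OF Ints_1, of "1 - z"] by auto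
  have sin: "sin (of_real pi * z) \<noteq> 0"
    using z by (auto simp: sin_eq_0)
  have "((\<lambda>z. Gamma z * Gamma (1 - z)) has_field_derivative
      (Gamma z * Gamma (1 - z)) * (Digamma z - Digamma (1 - z))) (at z)"
    using nz by (auto intro!: derivative_eq_intros simp: algebra_simps)
  then have "((\<lambda>z. of_real pi / sin (of_real pi * z)) has_field_derivative
      (of_real pi / sin (of_real pi * z)) * (Digamma z - Digamma (1 - z))) (at z)"
    by (simp only: Gamma_reflection_complex)
  moreover have "((\<lambda>z. of_real pi / sin (of_real pi * z)) has_field_derivative
      (of_real pi / sin (of_real pi * z)) * - (of_real pi * cos (of_real pi * z) / sin (of_real pi * z))) (at z)"
    using sin by (auto intro!: derivative_eq_intros simp: field_simps power2_eq_square)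
  ultimately have "(of_real pi / sin (of_real pi * z)) * (Digamma z - Digamma (1 - z))
      = (of_real pi / sin (of_real pi * z)) * - (of_real pi * cos (of_real pi * z) / sin (of_real pi * z))"
    by (rule DERIV_unique)
  then show ?thesis using sin by (simp only: mult_cancel_left) auto
qed

lemma trigamma_reflection:
  fixes z :: complex
  assumes z: "z \<notin> \<int>"
  shows "Polygamma 1 z + Polygamma 1 (1 - z) = (of_real pi / sin (of_real pi * z))\<^sup>2"
proof -
  have nz: "z \<notin> \<int>\<^sub>\<le>\<^sub>0" "1 - z \<notin> \<int>\<^sub>\<le>\<^sub>0"
    using z nonpos_Ints_Int Ints_diff[OF Ints_1, of "1 - z"] by auto
  have sin: "sin (of_real pi * z) \<noteq> 0"
    using z by (auto simp: sin_eq_0)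
  have "((\<lambda>z. Digamma z - Digamma (1 - z)) has_field_derivative Polygamma 1 z + Polygamma 1 (1 - z)) (at z)"
    using nz by (auto intro!: derivative_eq_intros)
  then have "((\<lambda>z. - (of_real pi * cos (of_real pi * z) / sin (of_real pi * z)))
      has_field_derivative Polygamma 1 z + Polygamma 1 (1 - z)) (at z)"
  proof (rule has_field_derivative_transform_within_open[where S = "- \<int>"])
    show "open (- \<int> :: complex set)" by (simp add: open_Compl)
  qed (use z Digamma_reflection in auto)
  moreover have "((\<lambda>z. - (of_real pi * cos (of_real pi * z) / sin (of_real pi * z)))
      has_field_derivative (of_real pi)\<^sup>2 * ((sin (of_real pi * z))\<^sup>2 + (cos (of_real pi * z))\<^sup>2)
        / (sin (of_real pi * z))\<^sup>2) (at z)"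
    using sin by (auto intro!: derivative_eq_intros simp: field_simps power2_eq_square
      simp del: sin_cos_squared_add sin_cos_squared_add2 sin_cos_squared_add3)
  ultimately have "Polygamma 1 z + Polygamma 1 (1 - z)
      = (of_real pi)\<^sup>2 * ((sin (of_real pi * z))\<^sup>2 + (cos (of_real pi * z))\<^sup>2) / (sin (of_real pi * z))\<^sup>2"
    by (rule DERIV_unique)
  then show ?thesis by (simp add: power_divide)
qed

lemma Re_half_notin_Ints:
  assumes "Re z = 1 / 2"
  shows "z \<notin> \<int>"
proof
  assume "z \<in> \<int>"
  then obtain n where "z = of_int n" by (rule Ints_cases)
  with assms have "of_int (2 * n) = (of_int 1 :: real)" by simp
  then show False unfolding of_int_eq_iff by presburger
qed

text \<open>
  On the line of real part \<open>1/2\<close> reflection is conjugation, and the sine becomes a hyperbolic cosine.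
\<close>

lemma trigamma_half_plus_cnj:
  fixes s :: real
  shows "Polygamma 1 (1 / 2 - \<i> * s / pi) + Polygamma 1 (1 / 2 + \<i> * s / pi) = (pi / cosh s)\<^sup>2"
proof -
  define z :: complex where "z = 1 / 2 - \<i> * s / pi"
  have "Re z = 1 / 2" by (simp add: z_def)
  then have "z \<notin> \<int>" by (rule Re_half_notin_Ints)
  from trigamma_reflection[OF this]
  have "Polygamma 1 z + Polygamma 1 (1 - z) = (of_real pi / sin (of_real pi * z))\<^sup>2" .
  moreover have "of_real pi * z = of_real pi / 2 - \<i> * s" by (simp add: z_def algebra_simps)
  then have "sin (of_real pi * z) = of_real (cosh s)"
    by (simp add: sin_diff cosh_conv_cos[symmetric] cosh_field_def cosh_def exp_of_real[symmetric] del: exp_of_real)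
  ultimately show ?thesis by (simp add: z_def)
qed

text \<open>
  The previous identity, differentiated in \<open>s\<close>.
\<close>

lemma tetragamma_half_minus_cnj:
  fixes s :: real
  shows "Polygamma 2 (1 / 2 - \<i> * s / pi) - Polygamma 2 (1 / 2 + \<i> * s / pi)
    = - \<i> * (2 * pi ^ 3 * sinh s / cosh s ^ 3)"
proof -
  have nz: "z \<notin> \<int>\<^sub>\<le>\<^sub>0" if "Re z = 1 / 2" for z :: complex
    using Re_half_notin_Ints[OF that] nonpos_Ints_Int by blast
  have P1: "((\<lambda>s. Polygamma 1 (1 / 2 + c * \<i> * of_real s / pi)) has_vector_derivative
      c * \<i> / pi * Polygamma 2 (1 / 2 + c * \<i> * s / pi)) (at s)" if "c \<in> \<real>" for c
  proof (rule has_vector_derivative_real_field)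
    have "1 / 2 + c * \<i> * complex_of_real s / complex_of_real pi \<notin> \<int>\<^sub>\<le>\<^sub>0"
      using that by (intro nz) (auto elim!: Reals_cases)
    then show "((\<lambda>s. Polygamma 1 (1 / 2 + c * \<i> * s / pi)) has_field_derivative
      c * \<i> / pi * Polygamma 2 (1 / 2 + c * \<i> * s / pi)) (at (of_real s))"
      by (auto intro!: derivative_eq_intros simp: numeral_2_eq_2)
  qed
  have "((\<lambda>s. Polygamma 1 (1 / 2 + (-1) * \<i> * of_real s / pi) + Polygamma 1 (1 / 2 + 1 * \<i> * of_real s / pi))
      has_vector_derivative (-1) * \<i> / pi * Polygamma 2 (1 / 2 + (-1) * \<i> * s / pi)
        + 1 * \<i> / pi * Polygamma 2 (1 / 2 + 1 * \<i> * s / pi)) (at s)"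
    by (intro has_vector_derivative_add P1) auto
  then have "((\<lambda>s. complex_of_real ((pi / cosh s)\<^sup>2)) has_vector_derivative
      - \<i> / pi * (Polygamma 2 (1 / 2 - \<i> * s / pi) - Polygamma 2 (1 / 2 + \<i> * s / pi))) (at s)"
    using trigamma_half_plus_cnj by (simp add: algebra_simps)
  moreover have "((\<lambda>s. complex_of_real ((pi / cosh s)\<^sup>2)) has_vector_derivative
      of_real (- 2 * pi\<^sup>2 * sinh s / cosh s ^ 3)) (at s)"
    by (rule has_vector_derivative_of_real)
       (auto intro!: derivative_eq_intros simp: field_simps power2_eq_square power3_eq_cube)
  ultimately have D: "- \<i> / pi * (Polygamma 2 (1 / 2 - \<i> * s / pi) - Polygamma 2 (1 / 2 + \<i> * s / pi))
      = of_real (- 2 * pi\<^sup>2 * sinh s / cosh s ^ 3)"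
    by (rule vector_derivative_unique_at)
  have "X = \<i> * pi * (- \<i> / pi * X)" for X :: complex by simp
  also note D
  finally show ?thesis by (simp add: power2_eq_square power3_eq_cube)
qed

section \<open>The Fourier transform of the weight\<close>

text \<open>
  The measure sought, multiplied by \<open>1 + x\<^sup>2\<close>; equivalently, \<open>x\<^sup>2\<close> times the density of the
  free Levy measure. By the convention for division by zero its value at \<open>0\<close> is \<open>0\<close> instead of the limit \<open>1/\<pi>\<close>,
  which no integral sees.
\<close>

definition cosh_weight :: "real \<Rightarrow> real" where
  "cosh_weight x = pi / 4 * x\<^sup>2 * (cosh (pi * x / 2) / (sinh (pi * x / 2))\<^sup>2)"

lemma cosh_weight_sums:
  assumes x: "x > 0"
  shows "(\<lambda>k. (real k + 1 / 2) * pi * exp (- ((real k + 1 / 2) * pi * x))) sums (cosh_weight x / x\<^sup>2)"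
proof -
  define q where "q = exp (- (pi * x / 2))"
  have q: "q > 0" "q < 1" using x by (simp_all add: q_def)
  then have q2: "norm (q\<^sup>2) < 1" "q\<^sup>2 \<noteq> 1"
    by (auto simp: power2_eq_1_iff power_less_one_iff abs_square_less_1)
  have "(\<lambda>k. pi / 2 * q * (2 * (real (Suc k) * (q\<^sup>2) ^ k) - (q\<^sup>2) ^ k)) sums
      (pi / 2 * q * (2 * (1 / (1 - q\<^sup>2)\<^sup>2) - 1 / (1 - q\<^sup>2)))"
    by (intro sums_mult sums_diff geometric_sums geometric_deriv_sums q2)
  moreover have "pi / 2 * q * (2 * (real (Suc k) * (q\<^sup>2) ^ k) - (q\<^sup>2) ^ k)
      = (real k + 1 / 2) * pi * exp (- ((real k + 1 / 2) * pi * x))" for k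
  proof -
    have "q * (q\<^sup>2) ^ k = q ^ (2 * k + 1)" by (simp add: power_mult)
    also have "\<dots> = exp (- ((real k + 1 / 2) * pi * x))"
      by (simp add: q_def exp_of_nat_mult[symmetric] algebra_simps del: power_Suc)
    finally show ?thesis by (simp add: algebra_simps)
  qed
  moreover have "pi / 2 * q * (2 * (1 / (1 - q\<^sup>2)\<^sup>2) - 1 / (1 - q\<^sup>2)) = cosh_weight x / x\<^sup>2"
  proof -
    have e: "exp (pi * x / 2) = 1 / q" by (simp add: q_def exp_minus field_simps)
    have c: "cosh (pi * x / 2) = (1 + q\<^sup>2) / (2 * q)" "sinh (pi * x / 2) = (1 - q\<^sup>2) / (2 * q)"
      using q by (simp_all add: cosh_def sinh_def e q_def[symmetric] field_simps power2_eq_square)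
    show ?thesis unfolding cosh_weight_def c
      using q q2(2) x by (simp add: divide_simps) (simp add: algebra_simps power2_eq_square)
  qed
  ultimately show ?thesis by (simp only:)
qed

text \<open>
  Termwise, \<open>2 c / (c - i s)\<^sup>3 = 2 / (c - i s)\<^sup>2 + 2 i s / (c - i s)\<^sup>3\<close>, and with
  \<open>c\<^sub>k - i s = \<pi> (k + 1/2 - i s/\<pi>)\<close> the two sums are polygamma values.
\<close>

lemma
  shows set_integrable_cosh_weight: "set_integrable lborel {0<..} cosh_weight"
    and fourier_cosh_weight_Ioi:
      "(LBINT x:{0<..}. iexp (s * x) * cosh_weight x)
        = 2 / pi\<^sup>2 * Polygamma 1 (1 / 2 - \<i> * s / pi) - \<i> * s / pi ^ 3 * Polygamma 2 (1 / 2 - \<i> * s / pi)"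
proof -
  define c where "c k = (real k + 1 / 2) * pi" for k
  have c: "c k > 0" for k by (simp add: c_def add_nonneg_pos)
  have "summable (\<lambda>k. inverse ((1 / 2 + real k)\<^sup>2))"
    by (rule Polygamma_converges') auto
  then have "summable (\<lambda>k. inverse (pi\<^sup>2) * inverse ((1 / 2 + real k)\<^sup>2))"
    by (rule summable_mult)
  moreover have "norm (complex_of_real (c k)) / c k ^ Suc 2 = inverse (pi\<^sup>2) * inverse ((1 / 2 + real k)\<^sup>2)" for k
  proof -
    have "norm (complex_of_real (c k)) / c k ^ Suc 2 = inverse ((c k)\<^sup>2)"
      using c[of k] by (simp add: field_simps power2_eq_square power3_eq_cube)
    then show ?thesis by (simp add: c_def power_mult_distrib mult.commute add.commute)
  qed
  ultimately have summable: "summable (\<lambda>k. norm (complex_of_real (c k)) / c k ^ Suc 2)" by simp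
  have sums: "(\<lambda>k. of_real (c k) * exp (- ((of_real (c k) - \<i> * s) * of_real t)))
      sums (iexp (s * t) * of_real (cosh_weight t / t\<^sup>2))" if "t > 0" for s t :: real
  proof -
    have "(\<lambda>k. iexp (s * t) * of_real (c k * exp (- (c k * t)))) sums (iexp (s * t) * of_real (cosh_weight t / t\<^sup>2))"
      unfolding c_def by (rule sums_mult, rule sums_of_real, rule cosh_weight_sums[OF that])
    moreover have "iexp (s * t) * of_real (c k * exp (- (c k * t)))
        = of_real (c k) * exp (- ((of_real (c k) - \<i> * s) * of_real t))" for k
      by (simp add: exp_of_real[symmetric] exp_add[symmetric] algebra_simps del: exp_of_real)
    ultimately show ?thesis by (simp only:)
  qed
  have eq: "of_real t ^ 2 * (iexp (s * t) * of_real (cosh_weight t / t\<^sup>2)) = iexp (s * t) * of_real (cosh_weight t)"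
    for s t :: real by (cases "t = 0") (simp_all add: cosh_weight_def)
  have re: "Re (of_real (c k) - \<i> * s) = c k" for k and s :: real by simp
  have laplace: "set_integrable lborel {0<..} (\<lambda>t. iexp (s * t) * of_real (cosh_weight t))"
    "(\<lambda>k. of_real (c k) * fact 2 / (of_real (c k) - \<i> * s) ^ Suc 2) sums (LBINT t:{0<..}. iexp (s * t) * of_real (cosh_weight t))"
    for s :: real
    using termwise_laplace[where m = 2 and a = "\<lambda>k. of_real (c k) - \<i> * s" and b = "\<lambda>k. of_real (c k)",
        OF _ _ sums, unfolded re eq] c summable by auto
  show "set_integrable lborel {0<..} cosh_weight"
    using laplace(1)[of 0] unfolding set_integrable_def scaleR_conv_of_real
    by (simp add: of_real_mult[symmetric] complex_of_real_integrable_eq del: of_real_mult)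
  define z :: complex where "z = 1 / 2 - \<i> * s / pi"
  have z: "z \<noteq> 0" "z + of_nat k \<noteq> 0" for k
    by (auto simp: z_def complex_eq_iff)
  have cz: "of_real (c k) - \<i> * s = pi * (z + of_nat k)" for k
    by (simp add: c_def z_def algebra_simps)
  have "(\<lambda>k. 2 / pi\<^sup>2 * inverse ((z + of_nat k) ^ 2) + 2 * \<i> * s / pi ^ 3 * inverse ((z + of_nat k) ^ 3))
      sums (2 / pi\<^sup>2 * (\<Sum>k. inverse ((z + of_nat k) ^ 2)) + 2 * \<i> * s / pi ^ 3 * (\<Sum>k. inverse ((z + of_nat k) ^ 3)))"
    by (intro sums_add sums_mult summable_sums Polygamma_converges' z) auto
  moreover have "2 / pi\<^sup>2 * inverse ((z + of_nat k) ^ 2) + 2 * \<i> * s / pi ^ 3 * inverse ((z + of_nat k) ^ 3)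
      = of_real (c k) * fact 2 / (of_real (c k) - \<i> * s) ^ Suc 2" for k
  proof -
    have "of_real (c k) = pi * (z + of_nat k) + \<i> * s" using cz[of k] by (simp add: algebra_simps)
    then show ?thesis unfolding cz using z(2)[of k]
      by (simp add: fact_2 divide_simps) (simp add: algebra_simps power2_eq_square power3_eq_cube)
  qed
  ultimately have "(LBINT x:{0<..}. iexp (s * x) * cosh_weight x)
      = 2 / pi\<^sup>2 * (\<Sum>k. inverse ((z + of_nat k) ^ 2)) + 2 * \<i> * s / pi ^ 3 * (\<Sum>k. inverse ((z + of_nat k) ^ 3))"
    using laplace(2)[of s] sums_unique2 by (simp only:) blast
  then show "(LBINT x:{0<..}. iexp (s * x) * cosh_weight x)
        = 2 / pi\<^sup>2 * Polygamma 1 z - \<i> * s / pi ^ 3 * Polygamma 2 z"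
    by (simp add: Polygamma_def numeral_2_eq_2 numeral_3_eq_3)
qed

section \<open>The Catalan constant\<close>

text \<open>
  The series converges uniformly on the closed disc, so its sum is continuous there, and so is
  the dilogarithm at \<open>z\<close>; both agree on the radius leading to \<open>z\<close>.
\<close>

lemma dilog_sums_unit_circle:
  assumes z: "norm z = 1" "z \<in> slit_plane"
  shows "(\<lambda>k. z ^ Suc k / of_nat (Suc k) ^ 2) sums dilog z"
proof -
  define T where "T k w = w ^ Suc k / of_nat (Suc k) ^ 2" for k and w :: complex
  have bound: "norm (T k w) \<le> 1 / real (Suc k) ^ 2" if "w \<in> cball 0 1" for k w
    using that by (simp only: T_def norm_divide norm_power norm_of_nat)
      (intro divide_right_mono power_le_one, auto)
  have summable: "summable (\<lambda>k. 1 / real (Suc k) ^ 2)"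
    using inverse_squares_sums by (simp add: sums_iff add.commute)
  have "uniform_limit (cball 0 1) (\<lambda>n w. \<Sum>k<n. T k w) (\<lambda>w. \<Sum>k. T k w) sequentially"
    by (rule Weierstrass_m_test[OF bound summable])
  then have cont: "continuous_on (cball 0 1) (\<lambda>w. \<Sum>k. T k w)"
    by (rule uniform_limit_theorem[rotated])
       (auto intro!: always_eventually continuous_intros simp: T_def simp del: of_nat_Suc)
  have "((\<lambda>n. (1 - 1 / real (Suc n)) *\<^sub>R z) \<longlongrightarrow> (1 - 0) *\<^sub>R z) sequentially"
    by (intro tendsto_intros LIMSEQ_Suc[OF lim_const_over_n])
  then have lim: "((\<lambda>n. (1 - 1 / real (Suc n)) *\<^sub>R z) \<longlongrightarrow> z) sequentially" by simp
  have norm: "norm ((1 - 1 / real (Suc n)) *\<^sub>R z) < 1" for n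
    using z by (simp add: field_simps)
  have "((\<lambda>n. \<Sum>k. T k ((1 - 1 / real (Suc n)) *\<^sub>R z)) \<longlongrightarrow> (\<Sum>k. T k z)) sequentially"
  proof (rule continuous_on_tendsto_compose[OF cont lim])
    show "\<forall>\<^sub>F n in sequentially. (1 - 1 / real (Suc n)) *\<^sub>R z \<in> cball 0 1"
      using norm by (intro always_eventually allI) (auto simp only: mem_cball_0 less_imp_le)
  qed (use z in auto)
  moreover have "(\<Sum>k. T k ((1 - 1 / real (Suc n)) *\<^sub>R z)) = dilog ((1 - 1 / real (Suc n)) *\<^sub>R z)" for n
    using dilog_sums[OF norm[of n]] by (simp only: T_def sums_iff)
  ultimately have "((\<lambda>n. dilog ((1 - 1 / real (Suc n)) *\<^sub>R z)) \<longlongrightarrow> (\<Sum>k. T k z)) sequentially"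
    by simp
  moreover have "((\<lambda>n. dilog ((1 - 1 / real (Suc n)) *\<^sub>R z)) \<longlongrightarrow> dilog z) sequentially"
  proof (rule isCont_tendsto_compose[OF _ lim])
    show "isCont dilog z"
      using holomorphic_on_imp_continuous_on[OF dilog_holomorphic] open_slit_plane z
      by (simp add: continuous_on_eq_continuous_at)
  qed
  ultimately have "(\<Sum>k. T k z) = dilog z"
    by (rule LIMSEQ_unique)
  moreover have "summable (\<lambda>k. T k z)"
    by (rule summable_comparison_test'[OF summable]) (use bound z in auto)
  ultimately show ?thesis
    by (simp add: sums_iff T_def)
qed

lemma catalan_sums: "(\<lambda>k. (-1) ^ k / of_nat (2 * k + 1) ^ 2) sums catalan"
proof -
  define f where "f k = (\<i> ^ Suc k / of_nat (Suc k) ^ 2 - (- \<i>) ^ Suc k / of_nat (Suc k) ^ 2) / (2 * \<i>)" for k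
  have "\<i> \<in> slit_plane" "- \<i> \<in> slit_plane"
    by (simp_all add: slit_plane_iff complex_nonpos_Reals_iff)
  then have "f sums catalan"
    unfolding catalan_def f_def by (intro sums_divide sums_diff dilog_sums_unit_circle) auto
  moreover have "f n = 0" if "n \<notin> range (\<lambda>k. 2 * k)" for n
  proof -
    have "even (Suc n)" using that by (auto elim!: evenE)
    then show ?thesis unfolding f_def by (simp only: power_minus_even) simp
  qed
  moreover have "strict_mono (\<lambda>k::nat. 2 * k)" by (simp add: strict_mono_def)
  ultimately have "(\<lambda>k. f (2 * k)) sums catalan"
    using sums_mono_reindex[of "\<lambda>k. 2 * k" f catalan] by blast
  moreover have "f (2 * k) = (-1) ^ k / of_nat (2 * k + 1) ^ 2" for k
  proof -
    have "\<i> ^ Suc (2 * k) = \<i> * (-1) ^ k" "(- \<i>) ^ Suc (2 * k) = - (\<i> * (-1) ^ k)"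
      by (simp_all add: power_mult)
    then show ?thesis unfolding f_def
      by (simp only:) (simp add: diff_divide_distrib add_divide_distrib)
  qed
  ultimately show ?thesis by (simp only:)
qed

text \<open>
  Expand \<open>1 / cosh x = 2 \<Sum>k. (-1)\<^sup>k exp (- (2 k + 1) x)\<close>.
\<close>

lemma
  shows set_integrable_id_over_cosh: "set_integrable lborel {0<..} (\<lambda>x::real. x / cosh x)"
    and integral_id_over_cosh: "of_real (LBINT x:{0<..}. x / cosh x) = 2 * catalan"
proof -
  define a :: "nat \<Rightarrow> complex" where "a k = of_nat (2 * k + 1)" for k
  have "summable (\<lambda>k. inverse ((1 / 2 + real k)\<^sup>2))"
    by (rule Polygamma_converges') auto
  then have "summable (\<lambda>k. inverse ((1 / 2 + real k)\<^sup>2) / 2)"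
    by (rule summable_divide)
  moreover have "norm (2 * (-1) ^ k :: complex) / Re (a k) ^ Suc 1 = inverse ((1 / 2 + real k)\<^sup>2) / 2" for k
  proof -
    have "Re (a k) = 2 * (1 / 2 + real k)" by (simp add: a_def)
    then show ?thesis by (simp only:) (simp add: norm_mult norm_power power2_eq_square divide_simps, simp add: algebra_simps)
  qed
  ultimately have summable: "summable (\<lambda>k. norm (2 * (-1) ^ k :: complex) / Re (a k) ^ Suc 1)" by (simp only:)
  have sums: "(\<lambda>k. 2 * (-1) ^ k * exp (- (a k * of_real t))) sums of_real (1 / cosh t)" if t: "t > 0" for t :: real
  proof -
    have "(\<lambda>k. 2 * exp (- t) * (- (exp (- t))\<^sup>2) ^ k) sums (2 * exp (- t) * (1 / (1 - (- (exp (- t))\<^sup>2))))"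
      by (intro sums_mult geometric_sums) (use t in \<open>simp add: power_less_one_iff\<close>)
    moreover have "2 * exp (- t) * (1 / (1 - (- (exp (- t))\<^sup>2))) = 1 / cosh t"
      by (simp add: cosh_field_def exp_minus divide_simps power2_eq_square add_pos_pos[THEN less_imp_neq, symmetric])
    moreover have "2 * exp (- t) * (- (exp (- t))\<^sup>2) ^ k = 2 * (-1) ^ k * exp (- (real (2 * k + 1) * t))" for k
    proof -
      have "(- (exp (- t))\<^sup>2) ^ k = (-1) ^ k * exp (- t) ^ (2 * k)"
        by (simp add: power_minus[of "(exp (- t))\<^sup>2"] power_mult)
      moreover have "exp (- t) * exp (- t) ^ (2 * k) = exp (- (real (2 * k + 1) * t))"
        by (simp add: exp_of_nat_mult[symmetric] exp_add[symmetric] algebra_simps)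
      ultimately show ?thesis by simp
    qed
    ultimately have "(\<lambda>k. 2 * (-1) ^ k * exp (- (real (2 * k + 1) * t))) sums (1 / cosh t)" by (simp only:)
    from sums_of_real[OF this, where 'a = complex] show ?thesis
      by (simp add: a_def exp_of_real[symmetric] del: exp_of_real)
  qed
  have a: "Re (a k) > 0" for k by (simp add: a_def)
  note laplace = termwise_laplace[OF a summable sums]
  have eq: "of_real t ^ 1 * complex_of_real (1 / cosh t) = of_real (t / cosh t)" for t by simp
  show "set_integrable lborel {0<..} (\<lambda>x::real. x / cosh x)"
    using laplace(1) unfolding eq set_integrable_def scaleR_conv_of_real
    by (simp add: of_real_mult[symmetric] of_real_divide[symmetric] complex_of_real_integrable_eq del: of_real_mult of_real_divide)
  have "(\<lambda>k. 2 * ((-1) ^ k / of_nat (2 * k + 1) ^ 2)) sums (2 * catalan)"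
    by (intro sums_mult catalan_sums)
  moreover have "2 * (-1) ^ k * fact 1 / a k ^ Suc 1 = 2 * ((-1) ^ k / of_nat (2 * k + 1) ^ 2)" for k
    by (simp add: a_def power2_eq_square)
  ultimately have "2 * catalan = (LBINT t:{0<..}. complex_of_real (t / cosh t))"
    using laplace(2) unfolding eq by (intro sums_unique2[where f = "\<lambda>k. 2 * (-1) ^ k * fact 1 / a k ^ Suc 1"]) simp_all
  then show "of_real (LBINT x:{0<..}. x / cosh x) = 2 * catalan"
    by (simp only: set_integral_complex_of_real)
qed

section \<open>The weight as a measure\<close>

text \<open>
  The second derivative of \<open>s tanh s\<close>.
\<close>

definition cosh_symbol :: "real \<Rightarrow> real" where
  "cosh_symbol s = 2 / (cosh s)\<^sup>2 - 2 * s * sinh s / cosh s ^ 3"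

lemma fourier_cosh_weight_symmetric:
  "(LBINT x:{0<..}. iexp (s * x) * cosh_weight x) + (LBINT x:{0<..}. iexp (- s * x) * cosh_weight x)
    = cosh_symbol s"
proof -
  let ?z = "1 / 2 - \<i> * s / pi" and ?z' = "1 / 2 + \<i> * s / pi"
  have "(LBINT x:{0<..}. iexp (s * x) * cosh_weight x) + (LBINT x:{0<..}. iexp (- s * x) * cosh_weight x)
      = 2 / pi\<^sup>2 * (Polygamma 1 ?z + Polygamma 1 ?z') - \<i> * s / pi ^ 3 * (Polygamma 2 ?z - Polygamma 2 ?z')"
    using fourier_cosh_weight_Ioi[of s] fourier_cosh_weight_Ioi[of "- s"] by (simp add: algebra_simps)
  also have "\<dots> = cosh_symbol s"
    unfolding trigamma_half_plus_cnj tetragamma_half_minus_cnj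
    by (simp add: cosh_symbol_def power_divide mult.left_commute[of "complex_of_real s" \<i>])
  finally show ?thesis .
qed

lemma continuous_cosh_symbol: "isCont cosh_symbol s"
  unfolding cosh_symbol_def[abs_def] by (intro continuous_intros) auto

lemma
  fixes f :: "real \<Rightarrow> 'a::{banach, second_countable_topology}"
  assumes pos: "set_integrable lborel {0<..} f" and neg: "set_integrable lborel {0<..} (\<lambda>x. f (- x))"
  shows integrable_halves: "integrable lborel f"
    and integral_halves: "(LBINT x. f x) = (LBINT x:{0<..}. f x) + (LBINT x:{0<..}. f (- x))"
proof -
  define p where "p x = indicator {0<..} x *\<^sub>R f x" for x
  define n where "n x = indicator {0<..} x *\<^sub>R f (- x)" for x
  have p: "integrable lborel p" and n: "integrable lborel n"
    using pos neg by (simp_all add: set_integrable_def p_def[abs_def] n_def[abs_def])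
  have n': "integrable lborel (\<lambda>x. n (- x))"
    using lborel_integrable_real_affine[OF n, of "-1" 0] by simp
  have f0: "f = (\<lambda>x. if x = 0 then f 0 else p x + n (- x))"
  proof
    fix x
    show "f x = (if x = 0 then f 0 else p x + n (- x))"
      by (cases x "0::real" rule: linorder_cases) (auto simp: p_def n_def)
  qed
  have [measurable]: "p \<in> borel_measurable borel" "(\<lambda>x. n (- x)) \<in> borel_measurable borel"
    using borel_measurable_integrable[OF p] borel_measurable_integrable[OF n'] by simp_all
  have meas: "f \<in> borel_measurable lborel"
    by (subst f0) simp
  have AE: "AE x in lborel. p x + n (- x) = f x"
    using AE_lborel_singleton[of "0::real"] by eventually_elim (auto simp: p_def n_def indicator_def)
  show "integrable lborel f"
    by (rule integrable_cong_AE_imp[OF Bochner_Integration.integrable_add[OF p n'] meas AE])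
  have "(LBINT x. f x) = (LBINT x. p x + n (- x))"
    using p n' meas AE by (intro integral_cong_AE) auto
  also have "\<dots> = (LBINT x. p x) + (LBINT x. n (- x))"
    by (rule Bochner_Integration.integral_add[OF p n'])
  also have "(LBINT x. n (- x)) = (LBINT x. n x)"
    using lborel_integral_real_affine[of "-1" n 0] by simp
  finally show "(LBINT x. f x) = (LBINT x:{0<..}. f x) + (LBINT x:{0<..}. f (- x))"
    by (simp add: p_def n_def set_lebesgue_integral_def)
qed

lemma cosh_weight_nonneg: "cosh_weight x \<ge> 0"
  by (simp add: cosh_weight_def)

lemma cosh_weight_minus [simp]: "cosh_weight (- x) = cosh_weight x"
  by (simp add: cosh_weight_def)

lemma borel_measurable_cosh_weight [measurable]: "cosh_weight \<in> borel_measurable borel"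
  unfolding cosh_weight_def[abs_def] cosh_field_def sinh_field_def by measurable

lemma integrable_cosh_weight: "integrable lborel cosh_weight"
  by (rule integrable_halves) (simp_all add: set_integrable_cosh_weight)

definition weight_measure :: "real measure" where
  "weight_measure = density lborel cosh_weight"

lemma sets_weight_measure [measurable_cong, simp]: "sets weight_measure = sets borel"
  by (simp add: weight_measure_def)

lemma space_weight_measure [simp]: "space weight_measure = UNIV"
  by (simp add: weight_measure_def)

lemma finite_weight_measure: "finite_measure weight_measure"
proof (rule finite_measureI)
  have "emeasure weight_measure (space weight_measure) = (\<integral>\<^sup>+x. ennreal (cosh_weight x) \<partial>lborel)"
    by (simp add: weight_measure_def emeasure_density)
  also have "\<dots> = ennreal (LBINT x. cosh_weight x)"
    by (intro nn_integral_eq_integral integrable_cosh_weight AE_I2 cosh_weight_nonneg)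
  finally show "emeasure weight_measure (space weight_measure) \<noteq> \<infinity>" by simp
qed

lemma integral_weight_measure:
  fixes f :: "real \<Rightarrow> 'a::{banach, second_countable_topology}"
  assumes [measurable]: "f \<in> borel_measurable borel"
  shows "(LINT x|weight_measure. f x) = (LBINT x. cosh_weight x *\<^sub>R f x)"
  unfolding weight_measure_def
  by (intro integral_density) (auto simp: cosh_weight_nonneg)

lemma integral_weight_measure_reflect:
  fixes f :: "real \<Rightarrow> 'a::{banach, second_countable_topology}"
  assumes [measurable]: "f \<in> borel_measurable borel"
  shows "(LINT x|weight_measure. f (- x)) = (LINT x|weight_measure. f x)"
  using lborel_integral_real_affine[of "-1" "\<lambda>x. cosh_weight x *\<^sub>R f x" 0]
  by (simp add: integral_weight_measure)

lemma set_integrable_cosh_weight_scaleR: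
  fixes f :: "real \<Rightarrow> 'a::{banach, second_countable_topology}"
  assumes [measurable]: "f \<in> borel_measurable borel" and bound: "\<And>x. norm (f x) \<le> C"
  shows "set_integrable lborel {0<..} (\<lambda>x. cosh_weight x *\<^sub>R f x)"
proof (rule set_integrable_bound[where f = "\<lambda>x. C * cosh_weight x"])
  show "set_integrable lborel {0<..} (\<lambda>x. C * cosh_weight x)"
    by (intro set_integrable_mult_right set_integrable_cosh_weight)
  show "set_borel_measurable lborel {0<..} (\<lambda>x. cosh_weight x *\<^sub>R f x)"
    unfolding set_borel_measurable_def by measurable
  show "AE x in lborel. x \<in> {0<..} \<longrightarrow> norm (cosh_weight x *\<^sub>R f x) \<le> norm (C * cosh_weight x)"
  proof (intro AE_I2 impI)
    fix x
    have "norm (f x) \<le> \<bar>C\<bar>" using bound[of x] by simp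
    then show "norm (cosh_weight x *\<^sub>R f x) \<le> norm (C * cosh_weight x)"
      using mult_left_mono[of "norm (f x)" "\<bar>C\<bar>" "\<bar>cosh_weight x\<bar>"] by (simp add: abs_mult mult.commute)
  qed
qed

lemma integral_weight_measure_halves:
  fixes f :: "real \<Rightarrow> 'a::{banach, second_countable_topology}"
  assumes [measurable]: "f \<in> borel_measurable borel" and bound: "\<And>x. norm (f x) \<le> C"
  shows "(LINT x|weight_measure. f x)
    = (LBINT x:{0<..}. cosh_weight x *\<^sub>R f x) + (LBINT x:{0<..}. cosh_weight x *\<^sub>R f (- x))"
  unfolding integral_weight_measure[OF assms(1)]
  by (subst integral_halves) (use bound in \<open>auto intro!: set_integrable_cosh_weight_scaleR\<close>)

lemma char_weight_measure: "char weight_measure s = cosh_symbol s"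
proof -
  have "char weight_measure s = (LBINT x:{0<..}. cosh_weight x *\<^sub>R iexp (s * x)) + (LBINT x:{0<..}. cosh_weight x *\<^sub>R iexp (s * - x))"
    unfolding char_def by (rule integral_weight_measure_halves[where C = 1]) auto
  then show ?thesis
    using fourier_cosh_weight_symmetric[of s] by (simp add: scaleR_conv_of_real mult.commute)
qed

lemma resolvent_weight_measure:
  assumes w: "w > 0"
  shows "(LINT x|weight_measure. iexp (s * x) / (w - \<i> * x))
    = (LBINT u:{0<..}. exp (- (w * u)) * cosh_symbol (s + u))"
proof -
  have "(LINT x|weight_measure. iexp (s * x) / (w - \<i> * x))
      = (LBINT u:{0<..}. exp (- (w * u)) *\<^sub>R char weight_measure (s + u))"
    using w by (intro integral_iexp_resolvent finite_weight_measure) auto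
  also have "\<dots> = (LBINT u:{0<..}. complex_of_real (exp (- (w * u)) * cosh_symbol (s + u)))"
    by (simp add: char_weight_measure scaleR_conv_of_real)
  finally show ?thesis by (simp only: set_integral_complex_of_real)
qed

text \<open>
  As a characteristic function, \<open>cosh_symbol\<close> is bounded by the mass of the measure.
\<close>

lemma norm_cosh_symbol_le: "\<bar>cosh_symbol s\<bar> \<le> measure weight_measure UNIV"
  using norm_char_le_measure[OF finite_weight_measure sets_weight_measure, of s]
  by (simp add: char_weight_measure)

lemma set_integrable_exp_cosh_symbol:
  assumes "w > 0"
  shows "set_integrable lborel {0<..} (\<lambda>u. exp (- (w * u)) * cosh_symbol (s + u))"
proof -
  have "isCont (\<lambda>u. cosh_symbol (s + u)) u" for u
    using isCont_o2[OF _ continuous_cosh_symbol, of u "\<lambda>u. s + u"] by simp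
  then have "continuous_on {0<..} (\<lambda>u. cosh_symbol (s + u))"
    by (simp add: continuous_at_imp_continuous_on)
  then have "set_borel_measurable borel {0<..} (\<lambda>u. cosh_symbol (s + u))"
    by (intro set_measurable_continuous_on) auto
  from set_integrable_exp_scaleR[OF assms this, of "measure weight_measure UNIV"] show ?thesis
    by (simp add: norm_cosh_symbol_le)
qed

section \<open>The one-sided exponential average\<close>

definition cosh_primitive :: "real \<Rightarrow> real" where
  "cosh_primitive s = (LBINT x=0..s. x / cosh x)"

lemma has_real_derivative_cosh_primitive [derivative_intros]:
  "(cosh_primitive has_real_derivative s / cosh s) (at s)"
proof -
  let ?a = "- \<bar>s\<bar> - 1" and ?b = "\<bar>s\<bar> + 1"
  have "((\<lambda>u. LBINT x=ereal 0..u. x / cosh x) has_vector_derivative (s / cosh s)) (at s within {?a..?b})"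
    by (rule interval_integral_FTC2) (auto intro!: continuous_intros)
  then have "((\<lambda>u. LBINT x=ereal 0..u. x / cosh x) has_vector_derivative (s / cosh s)) (at s)"
    by (subst (asm) at_within_interior) (auto simp: interior_cbox)
  then show ?thesis
    by (simp add: cosh_primitive_def[abs_def] zero_ereal_def has_real_derivative_iff_has_vector_derivative)
qed

lemma cosh_primitive_minus: "cosh_primitive (- s) = cosh_primitive s"
proof -
  have "cosh_primitive (- s) = - (LBINT x=- s..0. x / cosh x)"
    unfolding cosh_primitive_def by (subst interval_integral_endpoints_reverse) simp
  also have "\<dots> = - (LBINT x=0..s. - (x / cosh x))"
    by (subst interval_integral_reflect) simp
  finally show ?thesis
    by (simp add: cosh_primitive_def interval_lebesgue_integral_uminus)
qed

lemma tendsto_cosh_primitive: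
  "(cosh_primitive \<longlongrightarrow> (LBINT x:{(0::real)<..}. x / cosh x)) at_top"
proof -
  have eq: "indicator {0..} x *\<^sub>R (x / cosh x) = indicator {0<..} x *\<^sub>R (x / cosh x)" for x :: real
    by (cases "x = 0") (auto simp: indicator_def)
  have "set_integrable lborel {0..} (\<lambda>x::real. x / cosh x)"
    using set_integrable_id_over_cosh by (simp only: set_integrable_def eq)
  then have "((\<lambda>b. LBINT x:{0..b::real}. x / cosh x) \<longlongrightarrow> (LBINT x:{(0::real)..}. x / cosh x)) at_top"
    by (intro tendsto_set_lebesgue_integral_at_top) auto
  moreover have "(LBINT x:{(0::real)..}. x / cosh x) = (LBINT x:{(0::real)<..}. x / cosh x)"
    by (simp only: set_lebesgue_integral_def eq)
  ultimately have "((\<lambda>b. LBINT x:{0..b::real}. x / cosh x) \<longlongrightarrow> (LBINT x:{(0::real)<..}. x / cosh x)) at_top"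
    by (simp only:)
  moreover have "eventually (\<lambda>b. (LBINT x:{0..b::real}. x / cosh x) = cosh_primitive b) at_top"
    using eventually_ge_at_top[of 0]
    by eventually_elim (simp add: cosh_primitive_def zero_ereal_def interval_integral_Icc)
  ultimately show ?thesis
    by (rule Lim_transform_eventually)
qed

definition catalan_real :: real where
  "catalan_real = (LBINT x:{0<..}. x / cosh x) / 2"

lemma catalan_eq_catalan_real: "catalan = of_real catalan_real"
  using integral_id_over_cosh by (simp add: catalan_real_def)

text \<open>
  With \<open>\<Phi> s = 2 cosh s (K - J s / 2) - s tanh s - 1\<close>, where \<open>J\<close> is \<open>cosh_primitive\<close>, this is
  \<open>\<Phi> s + \<Phi>' s\<close>. It solves \<open>y' = y - H\<close> because \<open>\<Phi> - \<Phi>'' = H\<close>. As \<open>\<Phi>\<close> is even, the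
  values at \<open>s\<close> and \<open>- s\<close> add up to \<open>2 \<Phi> s\<close>.
\<close>

definition half_resolvent :: "real \<Rightarrow> real" where
  "half_resolvent s = 2 * exp s * (catalan_real - cosh_primitive s / 2)
     - s * tanh s - 1 - s - tanh s - s / (cosh s)\<^sup>2"

lemma tanh_eq: "tanh (x :: real) = sinh x / cosh x"
  by (simp add: tanh_def)

lemma has_real_derivative_half_resolvent:
  "(half_resolvent has_real_derivative half_resolvent s - cosh_symbol s) (at s)"
proof -
  have sq: "(sinh s)\<^sup>2 = (cosh s)\<^sup>2 - 1" by (simp add: cosh_square_eq)
  have "(half_resolvent has_real_derivative
      2 * exp s * (catalan_real - cosh_primitive s / 2) - exp s * (s / cosh s)
       - (tanh s + s * (1 - (tanh s)\<^sup>2)) - 1 - (1 - (tanh s)\<^sup>2)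
       - (1 / (cosh s)\<^sup>2 - 2 * s * sinh s / cosh s ^ 3)) (at s)"
    unfolding half_resolvent_def[abs_def]
    by (auto intro!: derivative_eq_intros simp: field_simps power2_eq_square power3_eq_cube)
  moreover have "1 - (tanh s)\<^sup>2 = 1 / (cosh s)\<^sup>2"
    by (simp add: tanh_eq power_divide sq divide_simps)
  moreover have "exp s * (s / cosh s) = s + s * tanh s"
    by (simp add: cosh_plus_sinh[symmetric] tanh_eq add_divide_distrib algebra_simps)
  ultimately show ?thesis
    by (simp add: half_resolvent_def cosh_symbol_def algebra_simps)
qed

text \<open>
  The integrand has the primitive \<open>- exp (- u) half_resolvent (s + u)\<close>. At infinity the factor
  \<open>exp (- u)\<close> kills all terms of \<open>half_resolvent\<close> but \<open>2 exp (s + u) (K - J (s + u) / 2)\<close>, and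
  this one is killed because \<open>J\<close> tends to \<open>2 K\<close>.
\<close>

lemma integral_exp_cosh_symbol:
  "(LBINT u:{0<..}. exp (- u) * cosh_symbol (s + u)) = half_resolvent s"
proof -
  have "(LBINT u:{0<..}. exp (- u) * cosh_symbol (s + u)) = 0 - (- (exp (- 0) * half_resolvent (s + 0)))"
  proof (rule set_integral_FTC_Ioi)
    show "((\<lambda>u. - (exp (- u) * half_resolvent (s + u))) has_vector_derivative exp (- x) * cosh_symbol (s + x)) (at x)" for x
      unfolding has_real_derivative_iff_has_vector_derivative[symmetric]
      by (auto intro!: derivative_eq_intros DERIV_chain'[OF _ has_real_derivative_half_resolvent] simp: algebra_simps)
    show "isCont (\<lambda>u. exp (- u) * cosh_symbol (s + u)) x" for x
      by (intro continuous_intros isCont_o2[OF _ continuous_cosh_symbol])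
    show "set_integrable lborel {0<..} (\<lambda>u. exp (- u) * cosh_symbol (s + u))"
      using set_integrable_exp_cosh_symbol[of 1 s] by simp
    have "filterlim (\<lambda>u. s + u) at_top at_top"
      by (rule filterlim_tendsto_add_at_top[OF tendsto_const filterlim_ident])
    from filterlim_compose[OF tendsto_cosh_primitive this]
    have "((\<lambda>u. 2 * exp s * (catalan_real - cosh_primitive (s + u) / 2)) \<longlongrightarrow> 2 * exp s * (catalan_real - (LBINT x:{0<..}. x / cosh x) / 2)) at_top"
      by (intro tendsto_intros) auto
    moreover have "((\<lambda>u. exp (- u) * ((s + u) * tanh (s + u) + 1 + (s + u) + tanh (s + u) + (s + u) / (cosh (s + u))\<^sup>2)) \<longlongrightarrow> 0) at_top"
      by real_asymp
    ultimately have "((\<lambda>u. exp (- u) * ((s + u) * tanh (s + u) + 1 + (s + u) + tanh (s + u) + (s + u) / (cosh (s + u))\<^sup>2)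
       - 2 * exp s * (catalan_real - cosh_primitive (s + u) / 2)) \<longlongrightarrow> 0 - 2 * exp s * (catalan_real - (LBINT x:{0<..}. x / cosh x) / 2)) at_top"
      by (intro tendsto_diff)
    moreover have "exp (- u) * ((s + u) * tanh (s + u) + 1 + (s + u) + tanh (s + u) + (s + u) / (cosh (s + u))\<^sup>2)
       - 2 * exp s * (catalan_real - cosh_primitive (s + u) / 2) = - (exp (- u) * half_resolvent (s + u))" for u
    proof -
      have "exp s = exp (- u) * exp (s + u)" by (simp add: exp_add[symmetric])
      then show ?thesis by (simp only: half_resolvent_def) (simp add: algebra_simps)
    qed
    ultimately show "((\<lambda>u. - (exp (- u) * half_resolvent (s + u))) \<longlongrightarrow> 0) at_top"
      by (simp add: catalan_real_def)
  qed
  then show ?thesis by simp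
qed

lemma half_resolvent_symmetric:
  "half_resolvent s + half_resolvent (- s) = 2 * (2 * cosh s * (catalan_real - cosh_primitive s / 2) - s * tanh s - 1)"
  by (simp add: half_resolvent_def cosh_primitive_minus cosh_field_def algebra_simps)

section \<open>Laplace transforms and the Hurwitz zeta function\<close>

text \<open>
  Two integrations by parts, done at once: with \<open>G u = u tanh u\<close> the integrand
  \<open>exp (- w u) (G'' u - w\<^sup>2 G u)\<close> has the primitive \<open>exp (- w u) (G' u + w G u)\<close>, which
  vanishes at \<open>0\<close> and at infinity.
\<close>

lemma integral_laplace_cosh_symbol:
  assumes w: "w > 0"
  shows "(LBINT u:{0<..}. exp (- (w * u)) * cosh_symbol u)
    = w\<^sup>2 * (LBINT u:{0<..}. exp (- (w * u)) * (u * tanh u))"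
proof -
  have int: "set_integrable lborel {0<..} (\<lambda>u. exp (- (w * u)) * cosh_symbol u)"
    using set_integrable_exp_cosh_symbol[OF w, of 0] by simp
  have int': "set_integrable lborel {0<..} (\<lambda>u. exp (- (w * u)) * (u * tanh u))"
  proof (rule set_integrable_bound)
    show "set_integrable lborel {0<..} (\<lambda>u. norm (of_real u ^ 1 * exp (- (of_real w * of_real u :: complex))))"
      using w by (intro set_integrable_norm set_integrable_power_mult_exp) simp
    show "set_borel_measurable lborel {0<..} (\<lambda>u. exp (- (w * u)) * (u * tanh u))"
      unfolding set_borel_measurable_def tanh_real_altdef by measurable
    show "AE u in lborel. u \<in> {0<..} \<longrightarrow> norm (exp (- (w * u)) * (u * tanh u))
        \<le> norm (norm (of_real u ^ 1 * exp (- (of_real w * of_real u :: complex))))"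
    proof (intro AE_I2 impI)
      fix u :: real
      have "\<bar>tanh u\<bar> \<le> 1" using tanh_real_bounds[of u] by (simp add: abs_le_iff)
      then have "\<bar>u\<bar> * exp (- (w * u)) * \<bar>tanh u\<bar> \<le> \<bar>u\<bar> * exp (- (w * u)) * 1"
        by (intro mult_left_mono) auto
      then show "norm (exp (- (w * u)) * (u * tanh u))
        \<le> norm (norm (of_real u ^ 1 * exp (- (of_real w * of_real u :: complex))))"
        by (simp add: norm_mult abs_mult mult_ac)
    qed
  qed
  have "(LBINT u:{0<..}. exp (- (w * u)) * cosh_symbol u - w\<^sup>2 * (exp (- (w * u)) * (u * tanh u)))
      = 0 - exp (- (w * 0)) * (tanh 0 + 0 / (cosh 0)\<^sup>2 + w * (0 * tanh 0))"
  proof (rule set_integral_FTC_Ioi)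
    show "((\<lambda>u. exp (- (w * u)) * (tanh u + u / (cosh u)\<^sup>2 + w * (u * tanh u))) has_vector_derivative
        exp (- (w * u)) * cosh_symbol u - w\<^sup>2 * (exp (- (w * u)) * (u * tanh u))) (at u)" for u
    proof -
      have sq: "(sinh u)\<^sup>2 = (cosh u)\<^sup>2 - 1" by (simp add: cosh_square_eq)
      have t: "1 - (tanh u)\<^sup>2 = 1 / (cosh u)\<^sup>2"
        by (simp add: tanh_eq power_divide sq divide_simps)
      have "((\<lambda>u. exp (- (w * u)) * (tanh u + u / (cosh u)\<^sup>2 + w * (u * tanh u))) has_real_derivative
        - w * exp (- (w * u)) * (tanh u + u / (cosh u)\<^sup>2 + w * (u * tanh u))
        + exp (- (w * u)) * ((1 - (tanh u)\<^sup>2) + (1 / (cosh u)\<^sup>2 - 2 * u * sinh u / cosh u ^ 3) + w * (tanh u + u * (1 - (tanh u)\<^sup>2)))) (at u)"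
        by (auto intro!: derivative_eq_intros simp: field_simps power2_eq_square power3_eq_cube)
      then show ?thesis
        unfolding has_real_derivative_iff_has_vector_derivative[symmetric] t
        by (simp add: cosh_symbol_def algebra_simps power2_eq_square)
    qed
    show "isCont (\<lambda>u. exp (- (w * u)) * cosh_symbol u - w\<^sup>2 * (exp (- (w * u)) * (u * tanh u))) x" for x
      by (intro continuous_intros continuous_cosh_symbol) auto
    show "set_integrable lborel {0<..} (\<lambda>u. exp (- (w * u)) * cosh_symbol u - w\<^sup>2 * (exp (- (w * u)) * (u * tanh u)))"
      by (intro set_integral_diff set_integrable_mult_right int int')
    show "((\<lambda>u. exp (- (w * u)) * (tanh u + u / (cosh u)\<^sup>2 + w * (u * tanh u))) \<longlongrightarrow> 0) at_top"
      using w by real_asymp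
  qed
  also have "(LBINT u:{0<..}. exp (- (w * u)) * cosh_symbol u - w\<^sup>2 * (exp (- (w * u)) * (u * tanh u)))
      = (LBINT u:{0<..}. exp (- (w * u)) * cosh_symbol u) - w\<^sup>2 * (LBINT u:{0<..}. exp (- (w * u)) * (u * tanh u))"
    by (subst set_integral_diff(2)[OF int set_integrable_mult_right[OF int']]) simp
  finally show ?thesis by simp
qed

text \<open>
  The geometric series turns the integral into \<open>\<Sum>k. 1 / (c k + w)\<^sup>2\<close>.
\<close>

lemma
  fixes c w :: real
  assumes c: "c > 0" and w: "w > 0"
  shows set_integrable_hurwitz: "set_integrable lborel {0<..} (\<lambda>t. t * (exp (- (w * t)) / (1 - exp (- (c * t)))))"
    and integral_hurwitz: "of_real (LBINT t:{0<..}. t * (exp (- (w * t)) / (1 - exp (- (c * t)))))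
      = hurwitz_zeta 2 (of_real (w / c)) / of_real (c\<^sup>2)"
proof -
  define d where "d = w / c"
  have d: "d > 0" "w = c * d" using c w by (simp_all add: d_def)
  define a :: "nat \<Rightarrow> complex" where "a k = of_real (c * (real k + d))" for k
  have a: "Re (a k) > 0" for k using c d by (simp add: a_def add_nonneg_pos)
  have "summable (\<lambda>k. inverse (c\<^sup>2) * inverse ((d + real k)\<^sup>2))"
    by (intro summable_mult Polygamma_converges') (use d in auto)
  moreover have "norm (1 :: complex) / Re (a k) ^ Suc 1 = inverse (c\<^sup>2) * inverse ((d + real k)\<^sup>2)" for k
    by (simp add: a_def power2_eq_square inverse_eq_divide add.commute mult_ac)
  ultimately have summable: "summable (\<lambda>k. norm (1 :: complex) / Re (a k) ^ Suc 1)" by (simp only:)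
  have sums: "(\<lambda>k. 1 * exp (- (a k * of_real t))) sums of_real (exp (- (w * t)) / (1 - exp (- (c * t))))"
    if t: "t > 0" for t :: real
  proof -
    have "(\<lambda>k. exp (- (w * t)) * exp (- (c * t)) ^ k) sums (exp (- (w * t)) * (1 / (1 - exp (- (c * t)))))"
      by (intro sums_mult geometric_sums) (use c t in simp)
    moreover have "exp (- (w * t)) * exp (- (c * t)) ^ k = exp (- (c * (real k + d) * t))" for k
      using d(2) by (simp add: exp_of_nat_mult[symmetric] exp_add[symmetric] algebra_simps)
    ultimately have "(\<lambda>k. exp (- (c * (real k + d) * t))) sums (exp (- (w * t)) / (1 - exp (- (c * t))))" by simp
    from sums_of_real[OF this, where 'a = complex] show ?thesis
      by (simp add: a_def exp_of_real[symmetric] del: exp_of_real)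
  qed
  note laplace = termwise_laplace[OF a summable sums]
  have eq: "of_real t ^ 1 * complex_of_real (exp (- (w * t)) / (1 - exp (- (c * t))))
      = of_real (t * (exp (- (w * t)) / (1 - exp (- (c * t)))))" for t by simp
  show "set_integrable lborel {0<..} (\<lambda>t. t * (exp (- (w * t)) / (1 - exp (- (c * t)))))"
    using laplace(1) unfolding eq set_integrable_def scaleR_conv_of_real of_real_mult[symmetric]
      complex_of_real_integrable_eq by simp
  have "1 * fact 1 / a k ^ Suc 1 = 1 / (of_nat k + of_real d) powr 2 * (1 / of_real (c\<^sup>2))" for k
    by (simp add: a_def power2_eq_square mult_ac)
  then have "(\<lambda>k. 1 / (of_nat k + of_real d :: complex) powr 2 * (1 / of_real (c\<^sup>2))) sums
      of_real (LBINT t:{0<..}. t * (exp (- (w * t)) / (1 - exp (- (c * t)))))"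
    using laplace(2) unfolding eq set_integral_complex_of_real by (simp only:)
  from sums_mult2[OF this, of "of_real (c\<^sup>2)"]
  have "(\<lambda>k. 1 / (of_nat k + of_real d :: complex) powr 2) sums
      (of_real (LBINT t:{0<..}. t * (exp (- (w * t)) / (1 - exp (- (c * t))))) * of_real (c\<^sup>2))"
    using c by simp
  then have "hurwitz_zeta 2 (of_real d)
      = of_real (LBINT t:{0<..}. t * (exp (- (w * t)) / (1 - exp (- (c * t))))) * of_real (c\<^sup>2)"
    unfolding hurwitz_zeta_def by (rule sums_unique[symmetric])
  then show "of_real (LBINT t:{0<..}. t * (exp (- (w * t)) / (1 - exp (- (c * t)))))
      = hurwitz_zeta 2 (of_real (w / c)) / of_real (c\<^sup>2)"
    using c by (simp add: d_def[symmetric])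
qed

text \<open>
  With \<open>y = exp (- 2 u)\<close> one has \<open>tanh u = (1 - y) / (1 + y) = 4 / (1 - y\<^sup>2) - 2 / (1 - y) - 1\<close>.
  This trades the alternating series for two positive ones with steps \<open>4\<close> and \<open>2\<close>, which
  explains the arguments \<open>w/4\<close> and \<open>w/2\<close>.
\<close>

lemma integral_laplace_id_tanh:
  assumes w: "w > 0"
  shows "of_real (LBINT u:{0<..}. exp (- (w * u)) * (u * tanh u))
    = hurwitz_zeta 2 (of_real (w / 4)) / 4 - hurwitz_zeta 2 (of_real (w / 2)) / 2 - of_real (1 / w\<^sup>2)"
proof -
  define g where "g c t = t * (exp (- (w * t)) / (1 - exp (- (c * t))))" for c t :: real
  have id: "set_integrable lborel {0<..} (\<lambda>t. t * exp (- (w * t)))"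
    "(LBINT t:{0<..}. t * exp (- (w * t))) = 1 / w\<^sup>2"
  proof -
    have eq: "of_real t ^ 1 * exp (- (of_real w * of_real t)) = complex_of_real (t * exp (- (w * t)))" for t
      by (simp add: exp_of_real[symmetric] del: exp_of_real)
    show "set_integrable lborel {0<..} (\<lambda>t. t * exp (- (w * t)))"
      using set_integrable_power_mult_exp[of "of_real w" 1] w
      unfolding eq unfolding set_integrable_def scaleR_conv_of_real of_real_mult[symmetric] complex_of_real_integrable_eq
      by simp
    have "of_real (LBINT t:{0<..}. t * exp (- (w * t))) = complex_of_real (1 / w\<^sup>2)"
      using integral_power_mult_exp[of "of_real w" 1] w
      unfolding eq set_integral_complex_of_real by (simp add: power2_eq_square)
    then show "(LBINT t:{0<..}. t * exp (- (w * t))) = 1 / w\<^sup>2" by (simp only: of_real_eq_iff)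
  qed
  have split: "exp (- (w * u)) * (u * tanh u) = 4 * g 4 u - 2 * g 2 u - u * exp (- (w * u))" if "u > 0" for u
  proof -
    define y where "y = exp (- (2 * u))"
    have y: "0 < y" "y < 1" using that by (simp_all add: y_def)
    have y2: "exp (- (4 * u)) = y * y" by (simp add: y_def exp_add[symmetric])
    have "1 - y \<noteq> 0" "1 - y * y \<noteq> 0" "1 + y \<noteq> 0"
      using y mult_strict_mono[of y 1 y 1] by auto
    then have "(1 - y) / (1 + y) = 4 / (1 - y * y) - 2 / (1 - y) - 1"
      by (simp add: divide_simps) (simp add: algebra_simps)
    then have tanh: "tanh u = 4 / (1 - y * y) - 2 / (1 - y) - 1"
      by (simp add: tanh_real_altdef y_def)
    show ?thesis unfolding g_def y2 y_def[symmetric] tanh by (simp add: algebra_simps)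
  qed
  have int: "set_integrable lborel {0<..} (g 4)" "set_integrable lborel {0<..} (g 2)"
    using set_integrable_hurwitz[of 4 w] set_integrable_hurwitz[of 2 w] w by (simp_all add: g_def[abs_def])
  have "(LBINT u:{0<..}. exp (- (w * u)) * (u * tanh u)) = (LBINT u:{0<..}. 4 * g 4 u - 2 * g 2 u - u * exp (- (w * u)))"
    by (rule set_lebesgue_integral_cong) (auto simp: split)
  also have "\<dots> = 4 * (LBINT u:{0<..}. g 4 u) - 2 * (LBINT u:{0<..}. g 2 u) - 1 / w\<^sup>2"
    by (simp add: int id)
  finally have "(LBINT u:{0<..}. exp (- (w * u)) * (u * tanh u))
      = 4 * (LBINT u:{0<..}. g 4 u) - 2 * (LBINT u:{0<..}. g 2 u) - 1 / w\<^sup>2" .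
  moreover have "complex_of_real (LBINT u:{0<..}. g 4 u) = hurwitz_zeta 2 (of_real (w / 4)) / 16"
    "complex_of_real (LBINT u:{0<..}. g 2 u) = hurwitz_zeta 2 (of_real (w / 2)) / 4"
    using integral_hurwitz[of 4 w] integral_hurwitz[of 2 w] w unfolding g_def by simp_all
  ultimately show ?thesis
    by (simp only: of_real_diff of_real_mult of_real_numeral) simp
qed

section \<open>The representing measure\<close>

definition free_bdlp_measure :: "real measure" where
  "free_bdlp_measure = density weight_measure (\<lambda>x. 1 / (1 + x\<^sup>2))"

lemma sets_free_bdlp_measure [measurable_cong, simp]: "sets free_bdlp_measure = sets borel"
  by (simp add: free_bdlp_measure_def)

lemma space_free_bdlp_measure [simp]: "space free_bdlp_measure = UNIV"
  by (simp add: free_bdlp_measure_def)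

lemma one_plus_square_pos: "1 + x\<^sup>2 > (0 :: real)"
  by (simp add: add_pos_nonneg)

lemma finite_free_bdlp_measure: "finite_measure free_bdlp_measure"
proof (rule finite_measureI)
  have "emeasure free_bdlp_measure (space free_bdlp_measure) = (\<integral>\<^sup>+x. ennreal (1 / (1 + x\<^sup>2)) \<partial>weight_measure)"
    by (simp add: free_bdlp_measure_def emeasure_density)
  also have "\<dots> \<le> (\<integral>\<^sup>+x. 1 \<partial>weight_measure)"
    by (intro nn_integral_mono) (simp add: one_plus_square_pos)
  also have "\<dots> < \<infinity>"
    using finite_measure.emeasure_finite[OF finite_weight_measure, of UNIV] by (simp add: less_top)
  finally show "emeasure free_bdlp_measure (space free_bdlp_measure) \<noteq> \<infinity>" by simp
qed

lemma integral_free_bdlp_measure: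
  fixes f :: "real \<Rightarrow> 'a::{banach, second_countable_topology}"
  assumes [measurable]: "f \<in> borel_measurable borel"
  shows "(LINT x|free_bdlp_measure. f x) = (LINT x|weight_measure. (1 / (1 + x\<^sup>2)) *\<^sub>R f x)"
  unfolding free_bdlp_measure_def
  by (intro integral_density) (auto simp: less_imp_le[OF one_plus_square_pos])

lemma integrable_weight_measure_bounded:
  fixes f :: "real \<Rightarrow> 'a::{banach, second_countable_topology}"
  assumes "f \<in> borel_measurable borel" and "\<And>x. norm (f x) \<le> C"
  shows "integrable weight_measure f"
  using assms by (intro finite_measure.integrable_const_bound[OF finite_weight_measure, where B = C]) auto

lemma norm_resolvent_le:
  fixes w x :: real
  assumes "w > 0"
  shows "norm (1 / (w - \<i> * x)) \<le> 1 / w" "norm (1 / (w + \<i> * x)) \<le> 1 / w"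
  unfolding norm_divide norm_one
  using abs_Re_le_cmod[of "w - \<i> * x"] abs_Re_le_cmod[of "w + \<i> * x"] assms
  by (auto intro!: frac_le)

text \<open>
  Partial fractions \<open>1 / (1 + x\<^sup>2) = (1 / (1 - i x) + 1 / (1 + i x)) / 2\<close>; the second term
  is the reflection of the first, so its integral is the resolvent integral at \<open>- s\<close>.
\<close>

lemma char_free_bdlp_measure:
  "char free_bdlp_measure s
    = 2 * cosh s * (catalan_real - cosh_primitive s / 2) - s * tanh s - 1"
proof -
  have half: "(1 / (1 + x\<^sup>2)) *\<^sub>R iexp (s * x)
      = (iexp (s * x) / (of_real 1 - \<i> * x) + iexp (- s * - x) / (of_real 1 - \<i> * of_real (- x))) / 2" for x :: real
  proof -
    have "(of_real 1 - \<i> * x) * (of_real 1 - \<i> * of_real (- x)) = of_real (1 + x\<^sup>2)"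
      by (simp add: algebra_simps power2_eq_square)
    moreover have "of_real (1 + x\<^sup>2) \<noteq> (0 :: complex)"
      unfolding of_real_eq_0_iff using one_plus_square_pos[of x] by linarith
    moreover from this have "of_real 1 - \<i> * x \<noteq> 0" "of_real 1 - \<i> * of_real (- x) \<noteq> (0 :: complex)"
      unfolding calculation(1)[symmetric] by auto
    ultimately have "1 / (of_real 1 - \<i> * x) + 1 / (of_real 1 - \<i> * of_real (- x)) = 2 / of_real (1 + x\<^sup>2)"
      by (simp add: add_frac_eq)
    then have "iexp (s * x) * (1 / (of_real 1 - \<i> * x) + 1 / (of_real 1 - \<i> * of_real (- x))) / 2
        = iexp (s * x) * (2 / of_real (1 + x\<^sup>2)) / 2"
      by (simp only:)
    also have "\<dots> = (1 / (1 + x\<^sup>2)) *\<^sub>R iexp (s * x)"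
      unfolding scaleR_conv_of_real by (simp del: of_real_add)
    finally show ?thesis by (simp add: distrib_left)
  qed
  have int: "integrable weight_measure (\<lambda>x. iexp (s * x) / (of_real 1 - \<i> * x))" for s :: real
    using norm_resolvent_le(1)[of 1] by (intro integrable_weight_measure_bounded[where C = 1]) (auto simp: norm_divide)
  have refl: "(LINT x|weight_measure. iexp (- s * - x) / (of_real 1 - \<i> * of_real (- x)))
      = (LINT x|weight_measure. iexp (- s * x) / (of_real 1 - \<i> * x))"
    by (rule integral_weight_measure_reflect[of "\<lambda>x. iexp (- s * x) / (of_real 1 - \<i> * x)"]) measurable
  have int': "integrable weight_measure (\<lambda>x. iexp (- s * - x) / (of_real 1 - \<i> * of_real (- x)))"
    using norm_resolvent_le(2)[of 1] by (intro integrable_weight_measure_bounded[where C = 1]) (auto simp: norm_divide)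
  have "char free_bdlp_measure s = (LINT x|weight_measure. (1 / (1 + x\<^sup>2)) *\<^sub>R iexp (s * x))"
    unfolding char_def by (rule integral_free_bdlp_measure) measurable
  also have "\<dots> = ((LINT x|weight_measure. iexp (s * x) / (of_real 1 - \<i> * x))
      + (LINT x|weight_measure. iexp (- s * x) / (of_real 1 - \<i> * x))) / 2"
    unfolding half refl[symmetric] integral_divide_zero Bochner_Integration.integral_add[OF int int'] ..
  also have "\<dots> = of_real ((half_resolvent s + half_resolvent (- s)) / 2)"
    using resolvent_weight_measure[of 1 s] resolvent_weight_measure[of 1 "- s"]
      integral_exp_cosh_symbol[of s] integral_exp_cosh_symbol[of "- s"] by simp
  finally show ?thesis
    by (simp only: half_resolvent_symmetric) simp
qed

lemma char_free_bdlp_measure_cosine: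
  "char free_bdlp_measure s = (pi / 2) * (LBINT x=0..\<infinity>.
     cos (s * x) * (x\<^sup>2 / (1 + x\<^sup>2)) * (cosh (pi * x / 2) / (sinh (pi * x / 2))\<^sup>2))"
proof -
  define f where "f x = (1 / (1 + x\<^sup>2)) *\<^sub>R iexp (s * x)" for x
  have [measurable]: "f \<in> borel_measurable borel" unfolding f_def by measurable
  have bound: "norm (f x) \<le> 1" for x
    using one_plus_square_pos[of x] by (simp add: f_def)
  have int: "set_integrable lborel {0<..} (\<lambda>x. cosh_weight x *\<^sub>R f x)"
    "set_integrable lborel {0<..} (\<lambda>x. cosh_weight x *\<^sub>R f (- x))"
    using bound by (auto intro!: set_integrable_cosh_weight_scaleR)
  have "char free_bdlp_measure s = (LINT x|weight_measure. f x)"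
    unfolding char_def f_def by (rule integral_free_bdlp_measure) measurable
  also have "\<dots> = (LBINT x:{0<..}. cosh_weight x *\<^sub>R f x) + (LBINT x:{0<..}. cosh_weight x *\<^sub>R f (- x))"
    by (rule integral_weight_measure_halves[OF _ bound]) measurable
  also have "\<dots> = (LBINT x:{0<..}. cosh_weight x *\<^sub>R f x + cosh_weight x *\<^sub>R f (- x))"
    by (rule set_integral_add(2)[symmetric, OF int])
  also have "\<dots> = (LBINT x:{0<..}. complex_of_real (pi / 2 *
     (cos (s * x) * (x\<^sup>2 / (1 + x\<^sup>2)) * (cosh (pi * x / 2) / (sinh (pi * x / 2))\<^sup>2))))"
  proof (intro set_lebesgue_integral_cong allI impI)
    fix x :: real
    have "iexp (s * x) + iexp (s * - x) = of_real (2 * cos (s * x))"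
      by (simp add: cos_of_real[symmetric] cos_exp_eq mult_ac del: cos_of_real)
    then have "f x + f (- x) = (1 / (1 + x\<^sup>2)) *\<^sub>R of_real (2 * cos (s * x))"
      by (simp only: f_def power2_minus scaleR_add_right[symmetric])
    then show "cosh_weight x *\<^sub>R f x + cosh_weight x *\<^sub>R f (- x) = complex_of_real (pi / 2 *
     (cos (s * x) * (x\<^sup>2 / (1 + x\<^sup>2)) * (cosh (pi * x / 2) / (sinh (pi * x / 2))\<^sup>2)))"
      by (simp only: scaleR_add_right[symmetric]) (simp add: cosh_weight_def scaleR_conv_of_real mult_ac)
  qed simp
  finally show ?thesis
    by (simp only: set_integral_complex_of_real set_integral_mult_right interval_lebesgue_integral_0_infty)
qed

text \<open>
  The measure is even, so only the even part of the kernel contributes. Divided by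
  \<open>1 + x\<^sup>2\<close>, that part is \<open>i w / (w\<^sup>2 + x\<^sup>2)\<close>, which is \<open>i\<close> times the even part of the resolvent.
\<close>

lemma integral_kernel_free_bdlp_measure:
  fixes w :: real
  assumes w: "w > 0"
  shows "(LINT x|free_bdlp_measure. (\<i> * w * x - 1) / (\<i> * w + complex_of_real x))
    = - (\<i> * (1 + of_real (w\<^sup>2 / 2) * hurwitz_zeta 2 (of_real (w / 2)) - of_real (w\<^sup>2 / 4) * hurwitz_zeta 2 (of_real (w / 4))))"
proof -
  define g where "g x = (1 / (1 + x\<^sup>2)) *\<^sub>R ((\<i> * w * x - 1) / (\<i> * w + complex_of_real x))" for x
  define r where "r x = 1 / (w - \<i> * complex_of_real x)" for x
  have [measurable]: "g \<in> borel_measurable borel" "r \<in> borel_measurable borel"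
    unfolding g_def r_def by measurable
  have sum: "g x + g (- x) = \<i> * (r x + r (- x))" for x
  proof -
    have nz: "complex_of_real (w\<^sup>2 + x\<^sup>2) \<noteq> 0" "complex_of_real (1 + x\<^sup>2) \<noteq> 0"
      unfolding of_real_eq_0_iff using one_plus_square_pos[of x] w
      by (auto simp: add_pos_nonneg less_imp_neq[symmetric])
    have prod: "(\<i> * w + complex_of_real x) * (\<i> * w - complex_of_real x) = - of_real (w\<^sup>2 + x\<^sup>2)"
      "(w - \<i> * complex_of_real x) * (w + \<i> * complex_of_real x) = of_real (w\<^sup>2 + x\<^sup>2)"
      by (simp_all add: algebra_simps power2_eq_square)
    have nz': "\<i> * w + complex_of_real x \<noteq> 0" "\<i> * w - complex_of_real x \<noteq> 0"
      "w - \<i> * complex_of_real x \<noteq> 0" "w + \<i> * complex_of_real x \<noteq> 0"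
      using w by (auto simp: complex_eq_iff)
    have "(\<i> * w * x - 1) / (\<i> * w + complex_of_real x) + (- (\<i> * w * x) - 1) / (\<i> * w - complex_of_real x)
        = 2 * \<i> * w * of_real (1 + x\<^sup>2) / of_real (w\<^sup>2 + x\<^sup>2)"
    proof -
      have num: "(\<i> * w * x - 1) * (\<i> * w - complex_of_real x) + (- (\<i> * w * x) - 1) * (\<i> * w + complex_of_real x)
          = - (2 * \<i> * w * of_real (1 + x\<^sup>2))"
        by (simp add: algebra_simps power2_eq_square)
      show ?thesis unfolding add_frac_eq[OF nz'(1,2)] prod num by (simp del: of_real_add)
    qed
    moreover have "r x + r (- x) = 2 * w / of_real (w\<^sup>2 + x\<^sup>2)"
      using nz' by (simp add: r_def add_frac_eq prod)
    moreover have "g x + g (- x) = ((\<i> * w * x - 1) / (\<i> * w + complex_of_real x)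
        + (- (\<i> * w * x) - 1) / (\<i> * w - complex_of_real x)) / of_real (1 + x\<^sup>2)"
      by (simp add: g_def scaleR_conv_of_real add_divide_distrib mult.commute)
    ultimately show ?thesis
      using nz(2) by (simp del: of_real_add)
  qed
  have r_int: "integrable weight_measure r" "integrable weight_measure (\<lambda>x. r (- x))"
    using norm_resolvent_le[OF w]
    by (auto intro!: integrable_weight_measure_bounded[where C = "1 / w"] simp: r_def)
  have kernel: "(\<i> * w * x - 1) / (\<i> * w + complex_of_real x) = \<i> * w + (w\<^sup>2 - 1) * (- \<i>) * r x" for x :: real
    using w unfolding r_def by (intro characteristics_kernel_eq) simp
  have g_bound: "norm (g x) \<le> norm (\<i> * w) + norm (complex_of_real (w\<^sup>2 - 1) * (- \<i>)) * (1 / w)" for x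
  proof -
    have "norm (g x) \<le> norm (\<i> * w + (w\<^sup>2 - 1) * (- \<i>) * r x)"
      unfolding g_def kernel norm_scaleR using one_plus_square_pos[of x]
      by (intro mult_left_le_one_le) auto
    also have "\<dots> \<le> norm (\<i> * w) + norm (complex_of_real (w\<^sup>2 - 1) * (- \<i>) * r x)"
      by (rule norm_triangle_ineq)
    also have "\<dots> \<le> norm (\<i> * w) + norm (complex_of_real (w\<^sup>2 - 1) * (- \<i>)) * (1 / w)"
      unfolding norm_mult[of _ "r x"]
      by (intro add_left_mono mult_left_mono) (use norm_resolvent_le[OF w] in \<open>simp_all add: r_def\<close>)
    finally show ?thesis .
  qed
  have g_int: "integrable weight_measure g" "integrable weight_measure (\<lambda>x. g (- x))"
    by (rule integrable_weight_measure_bounded[OF _ g_bound]; measurable)+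
  have "2 * (LINT x|weight_measure. g x) = (LINT x|weight_measure. g x) + (LINT x|weight_measure. g (- x))"
    by (simp add: integral_weight_measure_reflect)
  also have "\<dots> = (LINT x|weight_measure. \<i> * (r x + r (- x)))"
    using g_int by (simp add: sum[symmetric])
  also have "\<dots> = 2 * (\<i> * (LINT x|weight_measure. r x))"
    using r_int by (simp add: integral_weight_measure_reflect)
  finally have "(LINT x|weight_measure. g x) = \<i> * (LINT x|weight_measure. r x)" by simp
  also have "(LINT x|weight_measure. r x) = of_real (LBINT u:{0<..}. exp (- (w * u)) * cosh_symbol u)"
    using resolvent_weight_measure[OF w, of 0] by (simp add: r_def)
  also have "\<dots> = of_real (w\<^sup>2) * of_real (LBINT u:{0<..}. exp (- (w * u)) * (u * tanh u))"
    by (simp add: integral_laplace_cosh_symbol[OF w])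
  also have "\<dots> = of_real (w\<^sup>2) * (hurwitz_zeta 2 (of_real (w / 4)) / 4 - hurwitz_zeta 2 (of_real (w / 2)) / 2 - of_real (1 / w\<^sup>2))"
    by (simp only: integral_laplace_id_tanh[OF w])
  also have "\<dots> = of_real (w\<^sup>2 / 4) * hurwitz_zeta 2 (of_real (w / 4)) - of_real (w\<^sup>2 / 2) * hurwitz_zeta 2 (of_real (w / 2)) - 1"
    using w by (simp add: right_diff_distrib)
  finally have "(LINT x|weight_measure. g x) = \<i> * (of_real (w\<^sup>2 / 4) * hurwitz_zeta 2 (of_real (w / 4)) - of_real (w\<^sup>2 / 2) * hurwitz_zeta 2 (of_real (w / 2)) - 1)" .
  moreover have "(LINT x|free_bdlp_measure. (\<i> * w * x - 1) / (\<i> * w + complex_of_real x)) = (LINT x|weight_measure. g x)"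
    unfolding g_def by (rule integral_free_bdlp_measure) measurable
  ultimately show ?thesis by (simp add: right_diff_distrib distrib_left)
qed

lemma integral_kernel_minus:
  fixes w :: real
  shows "(LINT x|M. (\<i> * of_real (- w) * x - 1) / (\<i> * of_real (- w) + complex_of_real x))
    = cnj (LINT x|M. (\<i> * w * x - 1) / (\<i> * w + complex_of_real x))"
  by (subst Bochner_Integration.integral_cnj[symmetric]) simp

theorem proposition5:
  fixes V :: "complex \<Rightarrow> complex"
  assumes V_pos: "\<And>w::real. w > 0 \<Longrightarrow>
      V (\<i> * w) = \<i> * (1 + w\<^sup>2 / 2 * hurwitz_zeta 2 (w / 2) - w\<^sup>2 / 4 * hurwitz_zeta 2 (w / 4))"
    and V_cnj: "\<And>w::real. w > 0 \<Longrightarrow> V (- (\<i> * w)) = cnj (V (\<i> * w))"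
  shows "\<exists>\<rho> :: real measure.
      (\<forall>a b \<rho>'. characteristics (\<lambda>z. - V z) a b \<rho>' \<longleftrightarrow> a = 0 \<and> b = 0 \<and> \<rho>' = \<rho>) \<and>
      measure \<rho> UNIV = 2 * catalan - 1 \<and>
      (\<forall>s::real.
         char \<rho> s = 2 * cosh s * (catalan - (1 / 2) * (LBINT x=0..s. x / cosh x)) - s * tanh s - 1 \<and>
         char \<rho> s = (pi / 2) * (LBINT x=0..\<infinity>.
           cos (s * x) * (x\<^sup>2 / (1 + x\<^sup>2)) * (cosh (pi * x / 2) / (sinh (pi * x / 2))\<^sup>2)))"
proof -
  let ?\<rho> = free_bdlp_measure
  have chars: "characteristics (\<lambda>z. - V z) 0 0 ?\<rho>"
    unfolding characteristics_def
  proof (intro conjI allI impI)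
    fix w :: real assume "w \<noteq> 0"
    then consider "w > 0" | "w < 0" by linarith
    then show "- V (\<i> * w) = complex_of_real 0 + \<i> * complex_of_real 0 * w
        + (LINT x|?\<rho>. (\<i> * w * x - 1) / (\<i> * w + complex_of_real x))"
    proof cases
      case 1
      then show ?thesis
        unfolding V_pos[OF 1] integral_kernel_free_bdlp_measure[OF 1] by simp
    next
      case 2
      then have w: "- w > 0" by simp
      have "V (\<i> * w) = cnj (V (\<i> * of_real (- w)))"
        using V_cnj[OF w] by simp
      also have "\<dots> = - cnj (LINT x|?\<rho>. (\<i> * of_real (- w) * x - 1) / (\<i> * of_real (- w) + complex_of_real x))"
        unfolding V_pos[OF w] integral_kernel_free_bdlp_measure[OF w] by simp
      also have "\<dots> = - (LINT x|?\<rho>. (\<i> * w * x - 1) / (\<i> * w + complex_of_real x))"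
        unfolding integral_kernel_minus by simp
      finally show ?thesis by simp
    qed
  qed (simp_all add: finite_free_bdlp_measure)
  have char: "char ?\<rho> s = 2 * cosh s * (catalan - (1 / 2) * (LBINT x=0..s. x / cosh x)) - s * tanh s - 1" for s :: real
    unfolding char_free_bdlp_measure catalan_eq_catalan_real cosh_primitive_def by simp
  show ?thesis
  proof (intro exI conjI allI)
    show "characteristics (\<lambda>z. - V z) a b \<rho>' \<longleftrightarrow> a = 0 \<and> b = 0 \<and> \<rho>' = ?\<rho>" for a b \<rho>'
      using chars characteristics_unique[OF _ chars, of a b \<rho>'] by auto
    have "char ?\<rho> 0 = measure ?\<rho> UNIV"
      by (simp add: char_def scaleR_conv_of_real)
    then show "measure ?\<rho> UNIV = 2 * catalan - 1"
      using char[of 0] by (simp add: zero_ereal_def[symmetric])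
  qed (rule char char_free_bdlp_measure_cosine)+
qed

end
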